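(* Let $E$ be a Polish space with $\mathcal{E}=\mathcal{B}(E)$ its Borel $\sigma$-field, and let $(X_n)_{n\ge1}$ be a c.i.d. sequence of $E$-valued random variables on a probability space $(\Omega,\mathcal{A},P)$, with directing measure $\alpha$. Let $\pi_n$ be the $n$th coordinate projection on $E^\infty$ and let $\mathcal{V}$ be the $\sigma$-field on $E^\infty$ generated by the functions $$\limsup_n\frac1n\,[f(\pi_1)+\cdots+f(\pi_n)],\qquad f:E\to\mathbb{R}\text{ bounded measurable}.$$ Then the probability distribution $\lambda$ of $(X_n)_n$ on $\mathcal{E}^\infty$ coincides on $\mathcal{V}$ with the exchangeable law $\mu(\cdot)=\int\alpha^\infty(\omega)(\cdot)\,P(d\omega)$.
   Context: Let $\mathcal{G}^X_0=\{\varnothing,\Omega\}$ and $\mathcal{G}^X_n=\sigma(X_1,\dots,X_n)$. The sequence $(X_n)_{n\ge1}$ is c.i.d. (conditionally identically distributed) if, for all $k>n\ge0$ and all bounded measurable $f:E\to\mathbb{R}$, $E[f(X_k)\mid\mathcal{G}^X_n]=E[f(X_{n+1})\mid\mathcal{G}^X_n]$ a.s. In that case, for each bounded measurable $f$, $E[f(X_{n+1})\mid\mathcal{G}^X_n]$ converges a.s. and in $L^1$ to a random variable, denoted $V_f$. A random measure on $E$ is a map $\alpha$ from $\Omega$ to the set of probability measures on $\mathcal{B}(E)$ such that $\omega\mapsto\alpha(\omega)(B)$ is $\mathcal{A}$-measurable for each $B\in\mathcal{B}(E)$. The directing measure of the c.i.d. sequence $(X_n)_n$ is the (a.s. unique)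 random measure $\alpha$ on $E$ such that $V_f=\int f(t)\,\alpha(\cdot)(dt)$ a.s. for all bounded continuous $f:E\to\mathbb{R}$; it always exists when $E$ is Polish. $\alpha^\infty(\omega)=\alpha(\omega)\times\alpha(\omega)\times\cdots$ is the infinite product measure on $E^\infty$. *)

theory Defs
  imports "HOL-Probability.Probability"
begin

text \<open>
  Sequences are indexed from 0: \<open>X n\<close> and \<open>x n\<close> stand for \<open>X_{n+1}\<close> and \<open>\<pi>_{n+1}(x)\<close> in the
  usual numbering from 1. In particular \<open>X 0, \<dots>, X (n - 1)\<close> are the first \<open>n\<close> variables and
  \<open>X n\<close> is the next one to be predicted.
\<close>

definition seq_borel :: "(nat \<Rightarrow> 'e::topological_space) measure" where
  "seq_borel = PiM UNIV (\<lambda>_. borel)"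

definition past_field :: "'a measure \<Rightarrow> (nat \<Rightarrow> 'a \<Rightarrow> 'e::topological_space) \<Rightarrow> nat \<Rightarrow> 'a measure" where
  "past_field M X n = sigma (space M) {X i -` B \<inter> space M | i B. i < n \<and> B \<in> sets borel}"

text \<open>
  The condition \<open>k > n \<ge> 0\<close> on \<open>X_k\<close> in the numbering from 1 becomes \<open>k \<ge> n\<close> for \<open>X k\<close> here.
\<close>

definition cid :: "'a measure \<Rightarrow> (nat \<Rightarrow> 'a \<Rightarrow> 'e::topological_space) \<Rightarrow> bool" where
  "cid M X \<longleftrightarrow>
    (\<forall>n k. n \<le> k \<longrightarrow>
      (\<forall>f::'e \<Rightarrow> real. f \<in> borel_measurable borel \<longrightarrow> bounded (range f) \<longrightarrow>
        (AE \<omega> in M. real_cond_exp M (past_field M X n) (\<lambda>\<omega>'. f (X k \<omega>')) \<omega>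
                  = real_cond_exp M (past_field M X n) (\<lambda>\<omega>'. f (X n \<omega>')) \<omega>)))"

text \<open>
  The random variable \<open>V_f\<close>. For a c.i.d. sequence the limit exists almost surely; on the
  remaining null set the value of \<^const>\<open>lim\<close> is irrelevant.
\<close>

definition predictive_limit ::
    "'a measure \<Rightarrow> (nat \<Rightarrow> 'a \<Rightarrow> 'e::topological_space) \<Rightarrow> ('e \<Rightarrow> real) \<Rightarrow> 'a \<Rightarrow> real" where
  "predictive_limit M X f \<omega> =
    lim (\<lambda>n. real_cond_exp M (past_field M X n) (\<lambda>\<omega>'. f (X n \<omega>')) \<omega>)"

definition random_measure :: "'a measure \<Rightarrow> ('a \<Rightarrow> 'e::topological_space measure) \<Rightarrow> bool" where
  "random_measure M \<alpha> \<longleftrightarrow>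
    (\<forall>\<omega>\<in>space M. prob_space (\<alpha> \<omega>) \<and> sets (\<alpha> \<omega>) = sets borel) \<and>
    (\<forall>B\<in>sets borel. (\<lambda>\<omega>. measure (\<alpha> \<omega>) B) \<in> borel_measurable M)"

definition directing_measure ::
    "'a measure \<Rightarrow> (nat \<Rightarrow> 'a \<Rightarrow> 'e::topological_space) \<Rightarrow> ('a \<Rightarrow> 'e measure) \<Rightarrow> bool" where
  "directing_measure M X \<alpha> \<longleftrightarrow>
    random_measure M \<alpha> \<and>
    (\<forall>f::'e \<Rightarrow> real. continuous_on UNIV f \<longrightarrow> bounded (range f) \<longrightarrow>
      (AE \<omega> in M. predictive_limit M X f \<omega> = (\<integral>t. f t \<partial>\<alpha> \<omega>)))"

text \<open>
  The upper limit is taken in \<^typ>\<open>ereal\<close>; for bounded \<open>f\<close> it is finite. The term for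
  \<open>n = 0\<close> is \<open>0\<close> and does not affect it.
\<close>

definition limsup_average :: "('e \<Rightarrow> real) \<Rightarrow> (nat \<Rightarrow> 'e) \<Rightarrow> ereal" where
  "limsup_average f x = limsup (\<lambda>n. ereal (1 / real n * (\<Sum>i<n. f (x i))))"

definition limsup_field :: "(nat \<Rightarrow> 'e::topological_space) measure" where
  "limsup_field = sigma (space seq_borel)
    {limsup_average f -` B \<inter> space seq_borel | (f :: 'e \<Rightarrow> real) B.
       f \<in> borel_measurable borel \<and> bounded (range f) \<and> B \<in> sets borel}"

definition iid_mixture :: "'a measure \<Rightarrow> ('a \<Rightarrow> 'e::topological_space measure) \<Rightarrow> (nat \<Rightarrow> 'e) measure" where
  "iid_mixture M \<alpha> =
    measure_of (space seq_borel) (sets seq_borel)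
      (\<lambda>A. \<integral>\<^sup>+\<omega>. emeasure (PiM UNIV (\<lambda>_. \<alpha> \<omega>)) A \<partial>M)"

definition exchangeable_law :: "(nat \<Rightarrow> 'e::topological_space) measure \<Rightarrow> bool" where
  "exchangeable_law Q \<longleftrightarrow>
    prob_space Q \<and> sets Q = sets seq_borel \<and>
    (\<forall>p S. finite S \<longrightarrow> p permutes S \<longrightarrow> distr Q seq_borel (\<lambda>x i. x (p i)) = Q)"

text \<open>
  \<^const>\<open>iid_mixture\<close> really is the mixture, and \<^const>\<open>limsup_field\<close> really is a sub-\<open>\<sigma>\<close>-field of
  the product \<open>\<sigma>\<close>-field, so that no default value of \<^const>\<open>measure_of\<close> or \<^const>\<open>emeasure\<close>
  interferes.
\<close>

lemma sets_limsup_field: "sets limsup_field \<subseteq> sets seq_borel"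
proof -
  have "limsup_average f \<in> borel_measurable seq_borel"
    if [measurable]: "f \<in> borel_measurable borel" for f :: "'a \<Rightarrow> real"
    unfolding limsup_average_def[abs_def] seq_borel_def by measurable
  then have "{limsup_average f -` B \<inter> space seq_borel | (f :: 'a \<Rightarrow> real) B.
       f \<in> borel_measurable borel \<and> bounded (range f) \<and> B \<in> sets borel} \<subseteq> sets seq_borel"
    by (blast intro: measurable_sets)
  then show ?thesis
    unfolding limsup_field_def by (subst sets_measure_of) (blast dest: sets.sets_into_space, rule sets.sigma_sets_subset)
qed

lemma measurable_iid_power:
  assumes "random_measure M \<alpha>"
  shows "(\<lambda>\<omega>. PiM UNIV (\<lambda>_::nat. \<alpha> \<omega>)) \<in> M \<rightarrow>\<^sub>M prob_algebra seq_borel"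
proof (rule measurable_prob_algebra_generated[OF _ Int_stable_prod_algebra prod_algebra_sets_into_space])
  show "sets seq_borel = sigma_sets (\<Pi>\<^sub>E i\<in>UNIV. space borel) (prod_algebra UNIV (\<lambda>_. borel))"
    unfolding seq_borel_def by (rule sets_PiM)
next
  fix \<omega> assume w: "\<omega> \<in> space M"
  show "prob_space (PiM UNIV (\<lambda>_::nat. \<alpha> \<omega>))"
    using assms w by (intro prob_space_PiM) (auto simp: random_measure_def)
  show "sets (PiM UNIV (\<lambda>_::nat. \<alpha> \<omega>)) = sets seq_borel"
    unfolding seq_borel_def using assms w by (intro sets_PiM_cong) (auto simp: random_measure_def)
next
  fix A :: "(nat \<Rightarrow> 'b) set" assume "A \<in> prod_algebra UNIV (\<lambda>_. borel)"
  then obtain J E where J: "A = prod_emb UNIV (\<lambda>_. borel) J (Pi\<^sub>E J E)" "finite J"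
      "\<And>i. i \<in> J \<Longrightarrow> E i \<in> sets borel"
    by (rule prod_algebraE) auto
  have "emeasure (PiM UNIV (\<lambda>_::nat. \<alpha> \<omega>)) A = ennreal (\<Prod>j\<in>J. measure (\<alpha> \<omega>) (E j))"
    if w: "\<omega> \<in> space M" for \<omega>
  proof -
    have s: "sets (\<alpha> \<omega>) = sets borel" and p: "prob_space (\<alpha> \<omega>)"
      using assms w by (auto simp: random_measure_def)
    interpret p: prob_space "\<alpha> \<omega>" by (rule p)
    interpret product_prob_space "\<lambda>_::nat. \<alpha> \<omega>" UNIV by unfold_locales
    have "A = prod_emb UNIV (\<lambda>_. \<alpha> \<omega>) J (Pi\<^sub>E J E)"
      using J(1) sets_eq_imp_space_eq[OF s] by (simp add: prod_emb_def)
    with J(2,3) s show ?thesis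
      by (simp add: emeasure_PiM_emb p.emeasure_eq_measure prod_ennreal)
  qed
  moreover have "(\<lambda>\<omega>. ennreal (\<Prod>j\<in>J. measure (\<alpha> \<omega>) (E j))) \<in> borel_measurable M"
    using assms J(3) by (intro measurable_compose[OF _ measurable_ennreal] borel_measurable_prod)
      (auto simp: random_measure_def)
  ultimately show "(\<lambda>\<omega>. emeasure (PiM UNIV (\<lambda>_::nat. \<alpha> \<omega>)) A) \<in> borel_measurable M"
    by (simp cong: measurable_cong)
qed

lemma emeasure_iid_mixture:
  assumes "prob_space M" "random_measure M \<alpha>" "A \<in> sets seq_borel"
  shows "emeasure (iid_mixture M \<alpha>) A = (\<integral>\<^sup>+\<omega>. emeasure (PiM UNIV (\<lambda>_. \<alpha> \<omega>)) A \<partial>M)"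
proof -
  let ?K = "\<lambda>\<omega>. PiM UNIV (\<lambda>_::nat. \<alpha> \<omega>)"
  have K: "?K \<in> M \<rightarrow>\<^sub>M subprob_algebra seq_borel"
    by (rule measurable_prob_algebraD[OF measurable_iid_power[OF assms(2)]])
  have ne: "space M \<noteq> {}" by (rule prob_space.not_empty[OF assms(1)])
  have b: "emeasure (bind M ?K) B = (\<integral>\<^sup>+\<omega>. emeasure (?K \<omega>) B \<partial>M)" if "B \<in> sets seq_borel" for B
    by (rule emeasure_bind[OF ne K that])
  have "iid_mixture M \<alpha> = measure_of (space seq_borel) (sets seq_borel) (emeasure (bind M ?K))"
    unfolding iid_mixture_def
    by (intro measure_of_eq sets.space_closed) (simp add: b sets.sigma_sets_eq)
  also have "\<dots> = bind M ?K"
    using measure_of_of_measure[of "bind M ?K"] sets_bind[OF sets_kernel[OF K] ne] space_bind[OF sets_kernel[OF K] ne]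
    by simp
  finally show ?thesis using b[OF assms(3)] by simp
qed

end

theory Submission
  imports Defs
begin

text \<open>
  The predictions \<open>E[f(X_{n+1}) | G_n]\<close> of a c.i.d. sequence form a bounded martingale, which
  converges almost surely, and the differences \<open>f(X_{n+1}) - E[f(X_{n+1}) | G_n]\<close> are bounded and
  orthogonal, so their averages tend to 0. Hence the averages of \<open>f(X_i)\<close> converge almost surely
  to \<open>V_f\<close>. For bounded continuous \<open>f\<close> this limit is \<open>\<integral>f d\<alpha>\<close>; density of the continuous functions
  in \<open>L^1\<close> of the common law of the \<open>X_i\<close>, which is the mean of \<open>\<alpha>\<close>, extends this to bounded
  measurable \<open>f\<close>. By the strong law for i.i.d. sequences the limit is also
  \<open>\<integral>f d\<alpha>(\<omega>)\<close> almost surely under \<open>\<alpha>^\<infinity>(\<omega>)\<close>. The sets \<open>A\<close> with \<open>\<alpha>^\<infinity>(\<omega>)(A) = 1_A(X(\<omega>))\<close> for almost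
  every \<open>\<omega>\<close> form a \<open>\<sigma>\<close>-field, because only the values 0 and 1 occur; it contains the
  generators of \<open>\<V>\<close>, hence all of \<open>\<V>\<close>, and integrating over \<open>\<omega>\<close> gives the claim.
\<close>

subsection \<open>Maximal inequality and martingale convergence\<close>

text \<open>Doob's maximal inequality. Splitting the event by the first time at which the level
  \<open>c\<close> is reached, each piece lies in the field of that time, so the submartingale
  inequality carries the mass of \<open>Y\<close> on it forward to time \<open>k\<close>. The
  submartingale property is given in integrated form over the sets of \<open>F n\<close>.\<close>

lemma (in finite_measure) maximal_inequality:
  fixes Y :: "nat \<Rightarrow> 'a \<Rightarrow> real"
  assumes sub: "\<And>n. subalgebra M (F n)"
    and mono: "\<And>m n. m \<le> n \<Longrightarrow> sets (F m) \<subseteq> sets (F n)"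
    and adapted: "\<And>n. Y n \<in> borel_measurable (F n)"
    and int: "\<And>n. integrable M (Y n)"
    and nonneg: "\<And>n x. 0 \<le> Y n x"
    and submartingale: "\<And>n B. B \<in> sets (F n) \<Longrightarrow>
      (\<integral>x. indicator B x * Y n x \<partial>M) \<le> (\<integral>x. indicator B x * Y (Suc n) x \<partial>M)"
  shows "c * measure M {x \<in> space M. \<exists>j\<le>k. c \<le> Y j x} \<le> (\<integral>x. Y k x \<partial>M)"
proof -
  define B where "B k = {x \<in> space M. \<exists>j\<le>k. c \<le> Y j x}" for k
  have BF: "B k \<in> sets (F k)" for k
  proof -
    have "Y j \<in> borel_measurable (F k)" if "j \<le> k" for j
      using adapted[of j] measurable_mono[of borel borel "F j" "F k"] mono[OF that] sub[of j] sub[of k]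
      by (auto simp: subalgebra_def)
    then have "(\<Union>j\<in>{..k}. {x \<in> space (F k). c \<le> Y j x}) \<in> sets (F k)"
      by (intro sets.finite_UN) (simp_all add: borel_measurable_iff_ge)
    also have "(\<Union>j\<in>{..k}. {x \<in> space (F k). c \<le> Y j x}) = B k"
      using sub[of k] by (auto simp: B_def subalgebra_def)
    finally show ?thesis .
  qed
  have BM[measurable]: "B k \<in> sets M" for k
    using BF[of k] sub[of k] by (auto simp: subalgebra_def)
  have intB: "integrable M (\<lambda>x. indicator A x * Y n x)" if "A \<in> sets M" for A n
    using integrable_mult_indicator[OF that int[of n]] by simp
  have intc: "integrable M (\<lambda>x. indicator A x * c)" if "A \<in> sets M" for A
    using integrable_mult_indicator[OF that integrable_const[of c]] by simp
  have step: "c * measure M (B k) \<le> (\<integral>x. indicator (B k) x * Y k x \<partial>M)" for k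
  proof (induction k)
    case 0
    have "c * measure M (B 0) = (\<integral>x. indicator (B 0) x * c \<partial>M)"
      by simp
    also have "\<dots> \<le> (\<integral>x. indicator (B 0) x * Y 0 x \<partial>M)"
      by (intro integral_mono intc intB BM) (auto simp: B_def indicator_def)
    finally show ?case .
  next
    case (Suc k)
    \<comment> \<open>On \<open>?D\<close> the level \<open>c\<close> is reached for the first time
      at \<open>Suc k\<close>, so there \<open>Y (Suc k)\<close> itself is at least
      \<open>c\<close>.\<close>
    let ?D = "B (Suc k) - B k"
    have sub': "B k \<subseteq> B (Suc k)"
      by (auto simp: B_def intro: le_SucI)
    have "c * measure M ?D = (\<integral>x. indicator ?D x * c \<partial>M)"
      by simp
    also have "\<dots> \<le> (\<integral>x. indicator ?D x * Y (Suc k) x \<partial>M)"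
    proof (intro integral_mono intc intB)
      fix x
      show "indicator ?D x * c \<le> indicator ?D x * Y (Suc k) x"
        by (auto simp: B_def indicator_def le_Suc_eq)
    qed auto
    finally have D: "c * measure M ?D \<le> (\<integral>x. indicator ?D x * Y (Suc k) x \<partial>M)" .
    have "c * measure M (B (Suc k)) = c * measure M (B k) + c * measure M ?D"
      using sub' by (simp add: finite_measure_Diff algebra_simps)
    also have "\<dots> \<le> (\<integral>x. indicator (B k) x * Y (Suc k) x \<partial>M) + (\<integral>x. indicator ?D x * Y (Suc k) x \<partial>M)"
      using Suc submartingale[OF BF[of k]] D by simp
    also have "\<dots> = (\<integral>x. indicator (B k) x * Y (Suc k) x + indicator ?D x * Y (Suc k) x \<partial>M)"
      by (subst Bochner_Integration.integral_add) (auto intro: intB)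
    also have "\<dots> = (\<integral>x. indicator (B (Suc k)) x * Y (Suc k) x \<partial>M)"
      using sub' by (intro Bochner_Integration.integral_cong) (auto simp: indicator_def)
    finally show ?case .
  qed
  also have "(\<integral>x. indicator (B k) x * Y k x \<partial>M) \<le> (\<integral>x. Y k x \<partial>M)"
    using nonneg by (intro integral_mono intc intB int BM) (auto simp: indicator_def)
  finally show ?thesis
    by (simp add: B_def)
qed

text \<open>Orthogonality of martingale increments makes the second moments \<open>a n\<close>
  increasing; boundedness gives them a limit \<open>L\<close>. The maximal inequality for the
  squared increments after time \<open>m\<close> bounds the probability of an oscillation of size
  \<open>e\<close> after \<open>m\<close> by \<open>(L - a m) / e\<^sup>2\<close>, which is
  arbitrarily small, so almost every path is Cauchy.\<close>

lemma (in prob_space) bounded_martingale_convergent: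
  fixes V :: "nat \<Rightarrow> 'a \<Rightarrow> real"
  assumes sub: "\<And>n. subalgebra M (F n)"
    and mono: "\<And>m n. m \<le> n \<Longrightarrow> sets (F m) \<subseteq> sets (F n)"
    and adapted: "\<And>n. V n \<in> borel_measurable (F n)"
    and bounded: "\<And>n. AE x in M. \<bar>V n x\<bar> \<le> C"
    and martingale: "\<And>n. AE x in M. real_cond_exp M (F n) (V (Suc n)) x = V n x"
  shows "AE x in M. convergent (\<lambda>n. V n x)"
proof -
  have FM: "f \<in> borel_measurable M" if "f \<in> borel_measurable (F n)" for f :: "'a \<Rightarrow> real" and n
    using measurable_from_subalg[OF sub that] .
  have Fmono: "f \<in> borel_measurable (F n)" if "f \<in> borel_measurable (F m)" "m \<le> n" for f :: "'a \<Rightarrow> real" and m n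
    using that mono[OF that(2)] sub[of n] sub[of m] measurable_mono[of borel borel "F m" "F n"]
    by (auto simp: subalgebra_def)
  have VM[measurable]: "V n \<in> borel_measurable M" for n
    using FM[OF adapted] .
  have intV: "integrable M (V n)" for n
    using bounded[of n] by (intro integrable_const_bound[where B = C]) auto
  \<comment> \<open>The martingale property tested against a bounded \<open>F n\<close>-measurable
    factor; the cancellations below come from this form.\<close>
  have orth: "(\<integral>x. U x * V (Suc n) x \<partial>M) = (\<integral>x. U x * V n x \<partial>M)"
    if U: "U \<in> borel_measurable (F n)" and bd: "AE x in M. \<bar>U x\<bar> \<le> K" for U n K
  proof -
    interpret finite_measure_subalgebra M "F n"
      by unfold_locales (rule sub)
    have [measurable]: "U \<in> borel_measurable M"
      by (rule FM[OF U])
    have "AE x in M. norm (U x * V (Suc n) x) \<le> K * C"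
      using bd bounded[of "Suc n"] by eventually_elim (auto simp: abs_mult intro!: mult_mono)
    then have "integrable M (\<lambda>x. U x * V (Suc n) x)"
      by (rule integrable_const_bound) simp
    then have "(\<integral>x. U x * V (Suc n) x \<partial>M) = (\<integral>x. U x * real_cond_exp M (F n) (V (Suc n)) x \<partial>M)"
      using real_cond_exp_intg(2)[of U "V (Suc n)"] U by simp
    also have "\<dots> = (\<integral>x. U x * V n x \<partial>M)"
      by (rule integral_cong_AE) (use martingale[of n] in auto)
    finally show ?thesis .
  qed
  have intVV: "integrable M (\<lambda>x. V m x * V n x)" for m n
  proof (rule integrable_const_bound)
    show "AE x in M. norm (V m x * V n x) \<le> C * C"
      using bounded[of m] bounded[of n] by eventually_elim (auto simp: abs_mult intro!: mult_mono)
  qed simp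
  define a where "a n = (\<integral>x. V n x * V n x \<partial>M)" for n
  \<comment> \<open>Repeated use of \<open>orth\<close> with the factor \<open>V m\<close> lowers
    the later index one step at a time down to \<open>m\<close>.\<close>
  have cross: "(\<integral>x. V m x * V (m + k) x \<partial>M) = a m" for m k
  proof (induction k)
    case (Suc k)
    have "V m \<in> borel_measurable (F (m + k))"
      by (rule Fmono[OF adapted]) simp
    then show ?case
      using orth[of "V m" "m + k", OF _ bounded[of m]] Suc by simp
  qed (simp add: a_def)
  have incr: "(\<integral>x. (V (m + k) x - V m x)\<^sup>2 \<partial>M) = a (m + k) - a m" for m k
  proof -
    have "(\<integral>x. (V (m + k) x - V m x)\<^sup>2 \<partial>M)
        = (\<integral>x. V (m + k) x * V (m + k) x - 2 * (V m x * V (m + k) x) + V m x * V m x \<partial>M)"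
      by (rule Bochner_Integration.integral_cong) (auto simp: power2_eq_square algebra_simps)
    also have "\<dots> = a (m + k) - a m"
      using cross[of m k] by (simp add: intVV a_def)
    finally show ?thesis .
  qed
  have inc: "incseq a"
  proof (rule incseq_SucI)
    fix n
    have "0 \<le> (\<integral>x. (V (Suc n) x - V n x)\<^sup>2 \<partial>M)"
      by simp
    also have "\<dots> = a (Suc n) - a n"
      using incr[of n 1] by simp
    finally show "a n \<le> a (Suc n)"
      by simp
  qed
  have "a n \<le> C * C" for n
  proof -
    have "AE x in M. V n x * V n x \<le> C * C"
      using bounded[of n]
    proof eventually_elim
      case (elim x)
      then have "\<bar>V n x\<bar> * \<bar>V n x\<bar> \<le> C * C"
        by (intro mult_mono) auto
      then show ?case
        by simp
    qed
    then have "a n \<le> (\<integral>x. C * C \<partial>M)"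
      unfolding a_def by (intro integral_mono_AE intVV) auto
    then show ?thesis
      by (simp add: prob_space)
  qed
  then obtain L where L: "a \<longlonglongrightarrow> L" "\<And>n. a n \<le> L"
    using incseq_convergent[OF inc, of "C * C"] by blast
  \<comment> \<open>Along the shifted fields \<open>F (m + k)\<close> the squared increments from
    time \<open>m\<close> form a submartingale whose mean \<open>a (m + k) - a m\<close> is at most
    \<open>L - a m\<close>.\<close>
  have max: "e\<^sup>2 * prob {x \<in> space M. \<exists>j\<le>k. e\<^sup>2 \<le> (V (m + j) x - V m x)\<^sup>2} \<le> L - a m" for e m k
  proof -
    let ?Z = "\<lambda>k x. V (m + k) x - V m x"
    have Zm: "?Z k \<in> borel_measurable (F (m + k))" for k
      using adapted[of "m + k"] Fmono[OF adapted[of m], of "m + k"] by simp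
    have Zb: "AE x in M. \<bar>?Z k x\<bar> \<le> 2 * C" for k
      using bounded[of "m + k"] bounded[of m] by eventually_elim auto
    have intZ: "integrable M (\<lambda>x. (?Z k x)\<^sup>2)" for k
    proof (rule integrable_const_bound)
      show "AE x in M. norm ((?Z k x)\<^sup>2) \<le> (2 * C)\<^sup>2"
        using Zb[of k]
      proof eventually_elim
        case (elim x)
        then show ?case
          using power_mono[of "\<bar>?Z k x\<bar>" "2 * C" 2] by simp
      qed
    qed simp
    have "e\<^sup>2 * prob {x \<in> space M. \<exists>j\<le>k. e\<^sup>2 \<le> (?Z j x)\<^sup>2} \<le> (\<integral>x. (?Z k x)\<^sup>2 \<partial>M)"
    proof (rule maximal_inequality[where F = "\<lambda>k. F (m + k)"])
      show "subalgebra M (F (m + n))" for n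
        by (rule sub)
      show "sets (F (m + i)) \<subseteq> sets (F (m + j))" if "i \<le> j" for i j
        by (rule mono) (use that in simp)
      show "(\<lambda>x. (?Z n x)\<^sup>2) \<in> borel_measurable (F (m + n))" for n
        using Zm[of n] by simp
      show "integrable M (\<lambda>x. (?Z n x)\<^sup>2)" for n
        by (rule intZ)
      show "0 \<le> (?Z n x)\<^sup>2" for n x
        by simp
      fix n B assume B: "B \<in> sets (F (m + n))"
      then have BM[measurable]: "B \<in> sets M"
        using sub[of "m + n"] by (auto simp: subalgebra_def)
      \<comment> \<open>The factor in the cross term when \<open>(?Z (Suc n) x)\<^sup>2\<close> is
        expanded around \<open>?Z n x\<close> on \<open>B\<close>; \<open>orth\<close> makes that
        cross term vanish in the mean.\<close>
      let ?U = "\<lambda>x. indicator B x * ?Z n x"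
      have U: "?U \<in> borel_measurable (F (m + n))"
        using Zm[of n] B by simp
      have Ub: "AE x in M. \<bar>?U x\<bar> \<le> 2 * C"
        using Zb[of n] by eventually_elim (auto simp: indicator_def)
      have iU: "integrable M (\<lambda>x. ?U x * V k x)" for k
      proof (rule integrable_const_bound)
        show "AE x in M. norm (?U x * V k x) \<le> (2 * C) * C"
          using Ub bounded[of k]
        proof eventually_elim
          case (elim x)
          then show ?case
            unfolding real_norm_def abs_mult[of "?U x"] by (intro mult_mono) auto
        qed
      qed simp
      have iB: "integrable M (\<lambda>x. indicator B x * (?Z k x)\<^sup>2)" for k
        using integrable_mult_indicator[OF BM intZ[of k]] by simp
      have o: "(\<integral>x. ?U x * V (Suc (m + n)) x \<partial>M) = (\<integral>x. ?U x * V (m + n) x \<partial>M)"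
        by (rule orth[OF U Ub])
      \<comment> \<open>The added cross term has integral 0 by \<open>o\<close>. With it, the
        integrand falls short of the next one exactly by the square of a single martingale increment
        on \<open>B\<close>.\<close>
      have "(\<integral>x. indicator B x * (?Z n x)\<^sup>2 \<partial>M)
          = (\<integral>x. indicator B x * (?Z n x)\<^sup>2 + 2 * (?U x * V (Suc (m + n)) x - ?U x * V (m + n) x) \<partial>M)"
        using o by (simp add: iB iU)
      also have "\<dots> \<le> (\<integral>x. indicator B x * (?Z (Suc n) x)\<^sup>2 \<partial>M)"
      proof (rule integral_mono)
        show "integrable M (\<lambda>x. indicator B x * (?Z n x)\<^sup>2 + 2 * (?U x * V (Suc (m + n)) x - ?U x * V (m + n) x))"
          by (intro Bochner_Integration.integrable_add Bochner_Integration.integrable_diff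
              integrable_mult_right iB iU)
        show "integrable M (\<lambda>x. indicator B x * (?Z (Suc n) x)\<^sup>2)"
          by (rule iB)
        fix x
        have "0 \<le> (V (Suc (m + n)) x - V (m + n) x)\<^sup>2"
          by simp
        then show "indicator B x * (?Z n x)\<^sup>2 + 2 * (?U x * V (Suc (m + n)) x - ?U x * V (m + n) x)
            \<le> indicator B x * (?Z (Suc n) x)\<^sup>2"
          by (auto simp: indicator_def power2_eq_square algebra_simps)
      qed
      finally show "(\<integral>x. indicator B x * (?Z n x)\<^sup>2 \<partial>M) \<le> (\<integral>x. indicator B x * (?Z (Suc n) x)\<^sup>2 \<partial>M)" .
    qed
    also have "\<dots> \<le> L - a m"
      using incr[of m k] L(2)[of "m + k"] by simp
    finally show ?thesis .
  qed
  have null: "AE x in M. \<exists>m. \<forall>k. \<bar>V (m + k) x - V m x\<bar> < e" if e: "0 < e" for e :: real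
  proof -
    \<comment> \<open>\<open>N\<close> below collects the paths that, from every starting time
      \<open>m\<close>, move at least \<open>e\<close> away from \<open>V m x\<close>. For each
      \<open>m\<close> it lies in the union of the events \<open>S m k\<close>, so its probability
      obeys the maximal bound for all \<open>m\<close>.\<close>
    define S where "S m k = {x \<in> space M. \<exists>j\<le>k. e\<^sup>2 \<le> (V (m + j) x - V m x)\<^sup>2}" for m k
    define N where "N = {x \<in> space M. \<forall>m. \<exists>k. e \<le> \<bar>V (m + k) x - V m x\<bar>}"
    have [measurable]: "S m k \<in> sets M" "N \<in> sets M" for m k
      unfolding S_def N_def by measurable
    have "e\<^sup>2 * prob N \<le> L - a m" for m
    proof -
      have "(\<lambda>k. prob (S m k)) \<longlonglongrightarrow> prob (\<Union>k. S m k)"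
        by (rule finite_Lim_measure_incseq) (auto simp: incseq_def S_def intro: order_trans)
      then have "(\<lambda>k. e\<^sup>2 * prob (S m k)) \<longlonglongrightarrow> e\<^sup>2 * prob (\<Union>k. S m k)"
        by (rule tendsto_mult_left)
      then have "e\<^sup>2 * prob (\<Union>k. S m k) \<le> L - a m"
        by (rule LIMSEQ_le_const2) (use max[of e _ m] in \<open>auto simp: S_def\<close>)
      moreover have "N \<subseteq> (\<Union>k. S m k)"
      proof
        fix x assume x: "x \<in> N"
        then obtain k where "e \<le> \<bar>V (m + k) x - V m x\<bar>"
          by (auto simp: N_def)
        then have "e\<^sup>2 \<le> (V (m + k) x - V m x)\<^sup>2"
          using e power_mono[of e "\<bar>V (m + k) x - V m x\<bar>" 2] by simp
        then show "x \<in> (\<Union>k. S m k)"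
          using x by (auto simp: N_def S_def)
      qed
      then have "prob N \<le> prob (\<Union>k. S m k)"
        by (intro finite_measure_mono) auto
      then have "e\<^sup>2 * prob N \<le> e\<^sup>2 * prob (\<Union>k. S m k)"
        by (intro mult_left_mono) auto
      ultimately show ?thesis
        by linarith
    qed
    moreover have "(\<lambda>m. L - a m) \<longlonglongrightarrow> L - L"
      by (intro tendsto_intros L(1))
    ultimately have "e\<^sup>2 * prob N \<le> L - L"
      by (intro LIMSEQ_le_const[of "\<lambda>m. L - a m"]) auto
    then have "prob N \<le> 0"
      using e by (simp add: mult_le_0_iff)
    then have "prob N = 0"
      by (simp add: measure_le_0_iff)
    then have "AE x in M. x \<notin> N"
      by (subst (asm) prob_eq_0) auto
    then show ?thesis
      using AE_space by eventually_elim (auto simp: N_def not_le)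
  qed
  \<comment> \<open>Countably many thresholds suffice for the Cauchy property, so the exceptional
    null sets can be united.\<close>
  have "AE x in M. \<forall>i. \<exists>m. \<forall>k. \<bar>V (m + k) x - V m x\<bar> < inverse (real (Suc i))"
    unfolding AE_all_countable by (intro allI null) simp
  then show ?thesis
  proof eventually_elim
    case (elim x)
    show ?case
    proof (rule Cauchy_convergent, rule metric_CauchyI)
      fix e :: real assume "0 < e"
      then obtain i where i: "inverse (real (Suc i)) < e / 2"
        using reals_Archimedean[of "e / 2"] by auto
      obtain m where m: "\<And>k. \<bar>V (m + k) x - V m x\<bar> < inverse (real (Suc i))"
        using elim by blast
      have "dist (V p x) (V q x) < e" if "m \<le> p" "m \<le> q" for p q
        using m[of "p - m"] m[of "q - m"] that i by (simp add: dist_real_def)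
      then show "\<exists>M. \<forall>p\<ge>M. \<forall>q\<ge>M. dist (V p x) (V q x) < e"
        by blast
    qed
  qed
qed

subsection \<open>Averages of bounded orthogonal variables\<close>

text \<open>Cesaro means: the finitely many early terms contribute the constant \<open>K\<close>,
  which the division by \<open>n\<close> makes smaller than \<open>e / 2\<close>, and all later
  terms are within \<open>e / 2\<close> of \<open>l\<close>.\<close>

lemma average_tendsto:
  fixes v :: "nat \<Rightarrow> real"
  assumes "v \<longlonglongrightarrow> l"
  shows "(\<lambda>n. 1 / real n * (\<Sum>i<n. v i)) \<longlonglongrightarrow> l"
proof (rule LIMSEQ_I)
  fix e :: real assume e: "0 < e"
  obtain N where N: "\<And>n. N \<le> n \<Longrightarrow> \<bar>v n - l\<bar> < e / 2"
    using LIMSEQ_D[OF assms, of "e / 2"] e by auto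
  define K where "K = (\<Sum>i<N. \<bar>v i - l\<bar>)"
  have K: "0 \<le> K"
    by (simp add: K_def sum_nonneg)
  obtain p :: nat where p: "2 * K / e < real p"
    using reals_Archimedean2 by blast
  show "\<exists>no. \<forall>n\<ge>no. norm (1 / real n * (\<Sum>i<n. v i) - l) < e"
  proof (intro exI allI impI)
    fix n assume n: "max (Suc p) (Suc N) \<le> n"
    have "\<bar>(\<Sum>i<n. v i) - real n * l\<bar> = \<bar>\<Sum>i<n. v i - l\<bar>"
      by (simp add: sum_subtractf)
    also have "\<dots> \<le> (\<Sum>i<n. \<bar>v i - l\<bar>)"
      by (rule sum_abs)
    also have "\<dots> = K + (\<Sum>i\<in>{N..<n}. \<bar>v i - l\<bar>)"
      using n sum.atLeastLessThan_concat[of 0 N n "\<lambda>i. \<bar>v i - l\<bar>"]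
      by (simp add: K_def atLeast0LessThan)
    also have "(\<Sum>i\<in>{N..<n}. \<bar>v i - l\<bar>) \<le> (\<Sum>i\<in>{N..<n}. e / 2)"
      by (intro sum_mono less_imp_le[OF N]) simp
    also have "\<dots> \<le> real n * (e / 2)"
      using e by (simp add: mult_right_mono)
    also have "K < real n * (e / 2)"
    proof -
      have "2 * K < real p * e"
        using p e by (simp add: field_simps)
      also have "\<dots> \<le> real n * e"
        using n e by (intro mult_right_mono) auto
      finally show ?thesis
        by simp
    qed
    finally have "\<bar>(\<Sum>i<n. v i) - real n * l\<bar> < real n * e"
      by (simp add: mult.commute)
    then have "\<bar>(\<Sum>i<n. v i) - real n * l\<bar> / real n < e"
      using n by (subst pos_divide_less_eq) (simp_all add: mult.commute)
    moreover have "1 / real n * (\<Sum>i<n. v i) - l = ((\<Sum>i<n. v i) - real n * l) / real n"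
      using n by (simp add: diff_divide_distrib)
    ultimately show "norm (1 / real n * (\<Sum>i<n. v i) - l) < e"
      by simp
  qed
qed

text \<open>
  For \<open>m\<^sup>2 \<le> n < (m + 1)\<^sup>2\<close> the sums up to \<open>m\<^sup>2\<close> and up to \<open>n\<close> differ by at most \<open>2 m C\<close>. Along the squares,
  the second moments of the averages of orthogonal variables are summable.
\<close>

lemma average_tendsto_0_if_squares:
  fixes y :: "nat \<Rightarrow> real"
  assumes bounded: "\<And>i. \<bar>y i\<bar> \<le> C"
    and squares: "(\<lambda>m. (\<Sum>i<m\<^sup>2. y i) / real (m\<^sup>2)) \<longlonglongrightarrow> 0"
  shows "(\<lambda>n. 1 / real n * (\<Sum>i<n. y i)) \<longlonglongrightarrow> 0"
proof -
  have C: "0 \<le> C"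
    using bounded[of 0] by linarith
  have root: "filterlim floor_sqrt at_top sequentially"
    unfolding filterlim_at_top
  proof
    fix Z :: nat
    show "\<forall>\<^sub>F n in sequentially. Z \<le> floor_sqrt n"
      by (rule eventually_sequentiallyI[of "Z\<^sup>2"]) (simp add: le_floor_sqrt_iff)
  qed
  have 0: "(\<lambda>m. \<bar>(\<Sum>i<m\<^sup>2. y i) / real (m\<^sup>2)\<bar> + 2 * C / real m) \<longlonglongrightarrow> 0 + 0"
    by (intro tendsto_add tendsto_rabs_zero squares lim_const_over_n)
  have lim: "(\<lambda>n. \<bar>(\<Sum>i<(floor_sqrt n)\<^sup>2. y i) / real ((floor_sqrt n)\<^sup>2)\<bar> + 2 * C / real (floor_sqrt n)) \<longlonglongrightarrow> 0"
    using filterlim_compose[OF 0 root] by simp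
  show ?thesis
  proof (rule Lim_null_comparison[OF eventually_sequentiallyI[of 1] lim])
    fix n :: nat assume n: "1 \<le> n"
    define m where "m = floor_sqrt n"
    have m: "0 < m" "m\<^sup>2 \<le> n"
      using n by (simp_all add: m_def)
    have up: "n - m\<^sup>2 \<le> 2 * m"
      using Suc_floor_sqrt_power2_gt[of n] by (simp add: m_def power2_eq_square)
    have "(\<Sum>i<n. y i) = (\<Sum>i<m\<^sup>2. y i) + (\<Sum>i\<in>{m\<^sup>2..<n}. y i)"
      using m sum.atLeastLessThan_concat[of 0 "m\<^sup>2" n y] by (simp add: atLeast0LessThan)
    moreover have "\<bar>\<Sum>i\<in>{m\<^sup>2..<n}. y i\<bar> \<le> (\<Sum>i\<in>{m\<^sup>2..<n}. C)"
      by (rule order_trans[OF sum_abs]) (intro sum_mono bounded)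
    moreover have "(\<Sum>i\<in>{m\<^sup>2..<n}. C) = real (n - m\<^sup>2) * C"
      by simp
    moreover have "real (n - m\<^sup>2) * C \<le> real (2 * m) * C"
      using up C by (intro mult_right_mono) (simp_all only: of_nat_le_iff)
    ultimately have "\<bar>\<Sum>i<n. y i\<bar> \<le> \<bar>\<Sum>i<m\<^sup>2. y i\<bar> + 2 * C * real m"
      by (simp add: algebra_simps)
    then have "\<bar>\<Sum>i<n. y i\<bar> / real n \<le> (\<bar>\<Sum>i<m\<^sup>2. y i\<bar> + 2 * C * real m) / real n"
      by (rule divide_right_mono) simp
    also have "\<dots> \<le> (\<bar>\<Sum>i<m\<^sup>2. y i\<bar> + 2 * C * real m) / real (m\<^sup>2)"
      using m C n by (intro divide_left_mono) (simp_all only: of_nat_le_iff, auto)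
    also have "\<dots> = \<bar>(\<Sum>i<m\<^sup>2. y i) / real (m\<^sup>2)\<bar> + 2 * C / real m"
      using m by (simp add: add_divide_distrib power2_eq_square)
    finally show "norm (1 / real n * (\<Sum>i<n. y i))
        \<le> \<bar>(\<Sum>i<(floor_sqrt n)\<^sup>2. y i) / real ((floor_sqrt n)\<^sup>2)\<bar> + 2 * C / real (floor_sqrt n)"
      by (simp add: m_def abs_mult)
  qed
qed

text \<open>Orthogonality keeps the second moment of a sum of \<open>n\<close> terms below
  \<open>real n * (C * C)\<close>, so a series of squared averages along the squares has finite
  mean. It is then finite almost everywhere and its terms tend to 0; the bound on \<open>Y i\<close>
  fills the gaps between the squares.\<close>

lemma (in prob_space) orthogonal_strong_law:
  fixes Y :: "nat \<Rightarrow> 'a \<Rightarrow> real"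
  assumes [measurable]: "\<And>i. Y i \<in> borel_measurable M"
    and bounded: "\<And>i. AE x in M. \<bar>Y i x\<bar> \<le> C"
    and orthogonal: "\<And>i j. i < j \<Longrightarrow> (\<integral>x. Y i x * Y j x \<partial>M) = 0"
  shows "AE x in M. (\<lambda>n. 1 / real n * (\<Sum>i<n. Y i x)) \<longlonglongrightarrow> 0"
proof -
  have prod_bound: "AE x in M. \<bar>Y i x * Y j x\<bar> \<le> C * C" for i j
    using bounded[of i] bounded[of j] by eventually_elim (auto simp: abs_mult intro!: mult_mono)
  have intY: "integrable M (\<lambda>x. Y i x * Y j x)" for i j
    using prod_bound[of i j] by (intro integrable_const_bound[where B = "C * C"]) auto
  define S where "S n x = (\<Sum>i<n. Y i x)" for n x
  have [measurable]: "S n \<in> borel_measurable M" for n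
    unfolding S_def by measurable
  have S2: "integrable M (\<lambda>x. (S n x)\<^sup>2) \<and> (\<integral>x. (S n x)\<^sup>2 \<partial>M) \<le> real n * (C * C)" for n
  proof (induction n)
    case (Suc n)
    have eq: "(S (Suc n) x)\<^sup>2 = (S n x)\<^sup>2 + 2 * (\<Sum>i<n. Y i x * Y n x) + Y n x * Y n x" for x
      by (simp add: S_def power2_eq_square algebra_simps sum_distrib_left)
    have "(\<integral>x. (\<Sum>i<n. Y i x * Y n x) \<partial>M) = 0"
      by (simp add: intY orthogonal)
    then have "(\<integral>x. (S (Suc n) x)\<^sup>2 \<partial>M) = (\<integral>x. (S n x)\<^sup>2 \<partial>M) + (\<integral>x. Y n x * Y n x \<partial>M)"
      using Suc by (simp add: eq intY)
    moreover have "(\<integral>x. Y n x * Y n x \<partial>M) \<le> (\<integral>x. C * C \<partial>M)"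
      using prod_bound[of n n] by (intro integral_mono_AE intY) auto
    ultimately show ?case
      using Suc by (simp add: eq intY prob_space algebra_simps)
  qed (simp add: S_def)
  \<comment> \<open>Starting at \<open>Suc m\<close> avoids the division by 0 in the empty average;
    \<open>LIMSEQ_imp_Suc\<close> undoes the shift below.\<close>
  define T where "T m x = (S ((Suc m)\<^sup>2) x / real ((Suc m)\<^sup>2))\<^sup>2" for m x
  have T: "integrable M (T m)" "(\<integral>x. T m x \<partial>M) \<le> C * C * (1 / (real (Suc m))\<^sup>2)" for m
  proof -
    let ?q = "real ((Suc m)\<^sup>2)"
    have eq: "T m x = (S ((Suc m)\<^sup>2) x)\<^sup>2 / (?q)\<^sup>2" for x
      by (simp add: T_def power_divide)
    show "integrable M (T m)"
      using S2[of "(Suc m)\<^sup>2"] by (simp add: eq[abs_def])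
    have "(\<integral>x. T m x \<partial>M) = (\<integral>x. (S ((Suc m)\<^sup>2) x)\<^sup>2 \<partial>M) / (?q)\<^sup>2"
      by (simp add: eq)
    also have "\<dots> \<le> ?q * (C * C) / (?q)\<^sup>2"
      using S2[of "(Suc m)\<^sup>2"] by (intro divide_right_mono) auto
    also have "\<dots> = C * C * (1 / (real (Suc m))\<^sup>2)"
    proof -
      have "real ((Suc m)\<^sup>2) = (real (Suc m))\<^sup>2"
        by simp
      then show ?thesis
        by (simp add: power2_eq_square del: of_nat_Suc)
    qed
    finally show "(\<integral>x. T m x \<partial>M) \<le> C * C * (1 / (real (Suc m))\<^sup>2)" .
  qed
  have sq: "summable (\<lambda>m. C * C * (1 / (real (Suc m))\<^sup>2))"
    using inverse_power_summable[of 2, where 'a = real]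
    by (intro summable_mult) (subst summable_Suc_iff, simp add: inverse_eq_divide)
  \<comment> \<open>Monotone convergence exchanges sum and integral, so the nonnegative series of
    the \<open>T m\<close> has a finite mean.\<close>
  have "(\<integral>\<^sup>+x. (\<Sum>m. ennreal (T m x)) \<partial>M) = (\<Sum>m. \<integral>\<^sup>+x. ennreal (T m x) \<partial>M)"
    using T(1) by (intro nn_integral_suminf) auto
  also have "\<dots> = (\<Sum>m. ennreal (\<integral>x. T m x \<partial>M))"
    using T(1) by (subst nn_integral_eq_integral) (auto simp: T_def)
  also have "\<dots> \<le> (\<Sum>m. ennreal (C * C * (1 / (real (Suc m))\<^sup>2)))"
    using T(2) by (intro suminf_le ennreal_leI) auto
  also have "\<dots> < top"
    using sq by (subst suminf_ennreal2) (auto intro!: mult_nonneg_nonneg simp del: of_nat_Suc)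
  finally have "AE x in M. (\<Sum>m. ennreal (T m x)) \<noteq> top"
    using T(1) by (intro nn_integral_noteq_infinite[unfolded infinity_ennreal_def]) auto
  \<comment> \<open>One null set serves all \<open>i\<close>, since the passage from the squares to
    all \<open>n\<close> is made path by path.\<close>
  moreover have "AE x in M. \<forall>i. \<bar>Y i x\<bar> \<le> C"
    unfolding AE_all_countable using bounded by blast
  ultimately show ?thesis
  proof eventually_elim
    case (elim x)
    have "summable (\<lambda>m. T m x)"
      using elim by (intro summable_suminf_not_top) (auto simp: T_def)
    then have "(\<lambda>m. (S ((Suc m)\<^sup>2) x / real ((Suc m)\<^sup>2))\<^sup>2) \<longlonglongrightarrow> 0"
      unfolding T_def by (rule summable_LIMSEQ_zero)
    then have "(\<lambda>m. S ((Suc m)\<^sup>2) x / real ((Suc m)\<^sup>2)) \<longlonglongrightarrow> 0"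
      by (subst (asm) power_tendsto_0_iff) auto
    then have "(\<lambda>m. S (m\<^sup>2) x / real (m\<^sup>2)) \<longlonglongrightarrow> 0"
      by (rule LIMSEQ_imp_Suc)
    then show ?case
      using elim by (intro average_tendsto_0_if_squares[where C = C]) (auto simp: S_def)
  qed
qed

subsection \<open>Approximation by continuous functions\<close>

text \<open>The approximants are 1 on \<open>F\<close> and fall linearly with the distance to
  \<open>F\<close> at slope \<open>k\<close>. Off a closed \<open>F\<close> the distance is
  positive, so at each such point they vanish from some \<open>k\<close> on.\<close>

lemma closed_indicator_limit:
  fixes F :: "'e::metric_space set"
  assumes "closed F"
  obtains g :: "nat \<Rightarrow> 'e \<Rightarrow> real" where "\<And>k. continuous_on UNIV (g k)"
    "\<And>k x. 0 \<le> g k x" "\<And>k x. g k x \<le> 1" "\<And>x. (\<lambda>k. g k x) \<longlonglongrightarrow> indicator F x"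
proof (cases "F = {}")
  \<comment> \<open>\<open>infdist\<close> to the empty set is 0 by convention, so the formula used
    for nonempty \<open>F\<close> would give the constant 1.\<close>
  case True
  then show ?thesis
    by (intro that[of "\<lambda>_ _. 0"]) auto
next
  case False
  let ?g = "\<lambda>k x. max 0 (1 - real k * infdist x F)"
  show ?thesis
  proof (rule that[of ?g])
    show "continuous_on UNIV (?g k)" for k
      by (intro continuous_intros)
    show "0 \<le> ?g k x" "?g k x \<le> 1" for k x
      by (simp_all add: infdist_nonneg)
    show "(\<lambda>k. ?g k x) \<longlonglongrightarrow> indicator F x" for x
    proof (cases "x \<in> F")
      case True
      then show ?thesis
        by simp
    next
      case x: False
      then have d: "0 < infdist x F"
        using infdist_pos_not_in_closed[OF assms False] by blast
      obtain p :: nat where p: "1 / infdist x F < real p"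
        using reals_Archimedean2 by blast
      have "?g k x = 0" if "p \<le> k" for k
      proof -
        have "1 < real p * infdist x F"
          using p d by (simp add: field_simps)
        also have "\<dots> \<le> real k * infdist x F"
          using that d by (intro mult_right_mono) auto
        finally show ?thesis
          by simp
      qed
      then have "\<forall>\<^sub>F k in sequentially. ?g k x = indicator F x"
        using x by (intro eventually_sequentiallyI[of p]) auto
      then show ?thesis
        by (rule tendsto_eventually)
    qed
  qed
qed

text \<open>Closed sets form an intersection-stable generator of the Borel sets, and their
  indicators are limits of continuous functions with values in [0, 1]; dominated convergence
  transfers the equality to them.\<close>

lemma measure_eqI_continuous:
  fixes M N :: "'e::metric_space measure"
  assumes "finite_measure M" "finite_measure N" and sets: "sets M = sets borel" "sets N = sets borel"
    and eq: "\<And>f :: 'e \<Rightarrow> real. continuous_on UNIV f \<Longrightarrow> (\<And>x. 0 \<le> f x) \<Longrightarrow>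
      (\<And>x. f x \<le> 1) \<Longrightarrow> (\<integral>x. f x \<partial>M) = (\<integral>x. f x \<partial>N)"
  shows "M = N"
proof (rule measure_eqI_generator_eq[of "Collect closed" UNIV _ _ "\<lambda>_. UNIV"])
  interpret M: finite_measure M by fact
  interpret N: finite_measure N by fact
  show "sets M = sigma_sets UNIV (Collect closed)" "sets N = sigma_sets UNIV (Collect closed)"
    unfolding sets by (simp_all add: borel_eq_closed)
  fix F :: "'e set" assume "F \<in> Collect closed"
  then have F: "closed F"
    by simp
  obtain g :: "nat \<Rightarrow> 'e \<Rightarrow> real" where g: "\<And>k. continuous_on UNIV (g k)"
    "\<And>k x. 0 \<le> g k x" "\<And>k x. g k x \<le> 1" "\<And>x. (\<lambda>k. g k x) \<longlonglongrightarrow> indicator F x"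
    using closed_indicator_limit[OF F] by blast
  have lim: "(\<lambda>k. \<integral>x. g k x \<partial>Q) \<longlonglongrightarrow> measure Q F"
    if Q: "finite_measure Q" "sets Q = sets borel" for Q
  proof -
    interpret Q: finite_measure Q by fact
    have [measurable]: "F \<in> sets Q" "g k \<in> borel_measurable Q" for k
      using F borel_measurable_continuous_onI[OF g(1)[of k]]
      by (simp_all add: Q(2) measurable_cong_sets[OF Q(2) refl])
    have "(\<lambda>k. \<integral>x. g k x \<partial>Q) \<longlonglongrightarrow> (\<integral>x. indicator F x \<partial>Q)"
      by (rule integral_dominated_convergence[where w = "\<lambda>_. 1"]) (auto simp: g)
    then show ?thesis
      by simp
  qed
  have "(\<lambda>k. \<integral>x. g k x \<partial>M) = (\<lambda>k. \<integral>x. g k x \<partial>N)"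
    by (intro ext eq g)
  then have "measure M F = measure N F"
    using lim[of M] lim[of N] assms(1-4) LIMSEQ_unique by metis
  then show "emeasure M F = emeasure N F"
    by (simp add: M.emeasure_eq_measure N.emeasure_eq_measure)
qed (auto simp: Int_stable_def finite_measure.emeasure_finite[OF assms(1)])

text \<open>By induction over integrable functions. An indicator is approximated in two steps: from
  the set to a compact subset, by inner regularity of finite measures on a Polish space, and from
  the compact set to a continuous function, by \<open>closed_indicator_limit\<close>.\<close>

lemma continuous_dense_L1:
  fixes N :: "'e::polish_space measure" and f :: "'e \<Rightarrow> real"
  assumes "finite_measure N" and sets: "sets N = sets borel" and "integrable N f" and "0 < e"
  obtains g where "continuous_on UNIV g" "bounded (range g)" "integrable N g" "(\<integral>x. \<bar>f x - g x\<bar> \<partial>N) < e"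
proof -
  interpret finite_measure N by fact
  \<comment> \<open>The quantifier over \<open>e\<close> belongs to the induction predicate because
    sums and limits need their parts approximated up to \<open>e / 2\<close>.\<close>
  let ?P = "\<lambda>f :: 'e \<Rightarrow> real. \<forall>e>0. \<exists>g. continuous_on UNIV g \<and> bounded (range g) \<and> integrable N g \<and>
    (\<integral>x. \<bar>f x - g x\<bar> \<partial>N) < e"
  have cont[measurable]: "g \<in> borel_measurable N" if "continuous_on UNIV g" for g :: "'e \<Rightarrow> real"
    using borel_measurable_continuous_onI[OF that] by (simp add: measurable_cong_sets[OF sets refl])
  have tri: "(\<integral>x. \<bar>f x - h x\<bar> \<partial>N) \<le> (\<integral>x. \<bar>f x - g x\<bar> \<partial>N) + (\<integral>x. \<bar>g x - h x\<bar> \<partial>N)"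
    if [simp]: "integrable N f" "integrable N g" "integrable N h" for f g h :: "'e \<Rightarrow> real"
  proof -
    have "(\<integral>x. \<bar>f x - h x\<bar> \<partial>N) \<le> (\<integral>x. \<bar>f x - g x\<bar> + \<bar>g x - h x\<bar> \<partial>N)"
      by (intro integral_mono) auto
    then show ?thesis
      by simp
  qed
  from \<open>integrable N f\<close> have "?P f"
  proof induction
    case (base A c)
    show ?case
    proof (intro allI impI)
      fix e :: real assume e: "0 < e"
      \<comment> \<open>The two approximations cost \<open>d\<close> each and the result is scaled
        by \<open>\<bar>c\<bar>\<close>; adding 1 keeps the denominator positive when
        \<open>c = 0\<close>.\<close>
      define d where "d = e / (2 * (\<bar>c\<bar> + 1))"
      have d: "0 < d"
        using e by (simp add: d_def)
      have A: "A \<in> sets borel"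
        using base sets by simp
      have fin: "emeasure N A \<noteq> \<infinity>"
        by simp
      have "emeasure N A = (SUP K \<in> {K. K \<subseteq> A \<and> compact K}. emeasure N K)"
        by (rule inner_regular[OF sets _ A]) simp
      then have "\<exists>K\<in>{K. K \<subseteq> A \<and> compact K}. emeasure N A < emeasure N K + ennreal d"
        using compact_empty by (intro SUP_approx_ennreal[OF d]) (blast, assumption, rule fin)
      then obtain K where K: "K \<subseteq> A" "compact K" "emeasure N A < emeasure N K + ennreal d"
        by auto
      have clK: "closed K"
        using K(2) by (rule compact_imp_closed)
      have KM[measurable]: "K \<in> sets N"
        using clK sets by simp
      have AM[measurable]: "A \<in> sets N"
        using base by simp
      have "measure N A < measure N K + d"
        using K(3) d by (simp add: emeasure_eq_measure ennreal_plus[symmetric] ennreal_less_iff del: ennreal_plus)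
      then have AK: "(\<integral>x. \<bar>(indicator A x - indicator K x :: real)\<bar> \<partial>N) < d"
      proof -
        have "(\<integral>x. \<bar>(indicator A x - indicator K x :: real)\<bar> \<partial>N) = (\<integral>x. (indicator A x - indicator K x :: real) \<partial>N)"
          using K(1) by (intro Bochner_Integration.integral_cong) (auto simp: indicator_def)
        also have "\<dots> = measure N A - measure N K"
          by (simp add: emeasure_eq_measure)
        finally show ?thesis
          using \<open>measure N A < measure N K + d\<close> by simp
      qed
      obtain g :: "nat \<Rightarrow> 'e \<Rightarrow> real" where g: "\<And>k. continuous_on UNIV (g k)"
        "\<And>k x. 0 \<le> g k x" "\<And>k x. g k x \<le> 1" "\<And>x. (\<lambda>k. g k x) \<longlonglongrightarrow> indicator K x"
        using closed_indicator_limit[OF clK] by blast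
      have [measurable]: "g k \<in> borel_measurable N" for k
        by (rule cont[OF g(1)])
      have "(\<lambda>k. \<integral>x. \<bar>indicator K x - g k x\<bar> \<partial>N) \<longlonglongrightarrow> (\<integral>x. 0 \<partial>N)"
      proof (rule integral_dominated_convergence[where w = "\<lambda>_. 1"])
        show "AE x in N. (\<lambda>k. \<bar>indicator K x - g k x\<bar>) \<longlonglongrightarrow> 0"
        proof (rule AE_I2)
          fix x
          have "(\<lambda>k. \<bar>indicator K x - g k x\<bar>) \<longlonglongrightarrow> \<bar>indicator K x - indicator K x\<bar>"
            by (intro tendsto_intros g(4))
          then show "(\<lambda>k. \<bar>indicator K x - g k x\<bar>) \<longlonglongrightarrow> 0"
            by simp
        qed
        show "AE x in N. norm \<bar>indicator K x - g k x\<bar> \<le> 1" for k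
        proof (rule AE_I2)
          fix x
          show "norm \<bar>indicator K x - g k x\<bar> \<le> 1"
            using g(2,3)[of k x] by (auto simp: indicator_def)
        qed
      qed auto
      then obtain k where k: "(\<integral>x. \<bar>indicator K x - g k x\<bar> \<partial>N) < d"
        using order_tendstoD(2)[of _ "0::real" sequentially d] d
        by (auto simp: eventually_sequentially)
      have ig: "integrable N (g k)"
        using g(2,3)[of k] by (intro integrable_const_bound[where B = 1]) auto
      have iA: "integrable N (indicator A :: 'e \<Rightarrow> real)" "integrable N (indicator K :: 'e \<Rightarrow> real)"
        by (simp_all add: emeasure_eq_measure)
      have "(\<integral>x. \<bar>indicator A x - g k x\<bar> \<partial>N) < 2 * d"
        using tri[OF iA(1,2) ig] AK k by simp
      then have "\<bar>c\<bar> * (\<integral>x. \<bar>indicator A x - g k x\<bar> \<partial>N) \<le> \<bar>c\<bar> * (2 * d)"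
        by (intro mult_left_mono) auto
      also have "\<dots> < (\<bar>c\<bar> + 1) * (2 * d)"
        using d by (intro mult_strict_right_mono) auto
      also have "\<dots> = e"
        by (simp add: d_def field_simps)
      finally have le: "\<bar>c\<bar> * (\<integral>x. \<bar>indicator A x - g k x\<bar> \<partial>N) < e" .
      have "(\<integral>x. \<bar>indicator A x *\<^sub>R c - c * g k x\<bar> \<partial>N) = (\<integral>x. \<bar>c\<bar> * \<bar>indicator A x - g k x\<bar> \<partial>N)"
        by (intro Bochner_Integration.integral_cong) (simp_all add: abs_mult[symmetric] algebra_simps)
      then have "(\<integral>x. \<bar>indicator A x *\<^sub>R c - c * g k x\<bar> \<partial>N) < e"
        using le by simp
      moreover have "continuous_on UNIV (\<lambda>x. c * g k x)"
        by (intro continuous_intros g(1))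
      moreover have "bounded (range (\<lambda>x. c * g k x))"
        using g(2,3)[of k] by (intro boundedI[of _ "\<bar>c\<bar>"]) (auto simp: abs_mult intro!: mult_left_le)
      ultimately show "\<exists>g. continuous_on UNIV g \<and> bounded (range g) \<and> integrable N g \<and>
          (\<integral>x. \<bar>indicator A x *\<^sub>R c - g x\<bar> \<partial>N) < e"
        using ig by (intro exI[of _ "\<lambda>x. c * g k x"]) auto
    qed
  next
    case (add f h)
    show ?case
    proof (intro allI impI)
      fix e :: real assume "0 < e"
      then have e: "0 < e / 2"
        by simp
      obtain f' where f': "continuous_on UNIV f'" "bounded (range f')" "integrable N f'"
          "(\<integral>x. \<bar>f x - f' x\<bar> \<partial>N) < e / 2"
        using add(3) e by blast
      obtain h' where h': "continuous_on UNIV h'" "bounded (range h')" "integrable N h'"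
          "(\<integral>x. \<bar>h x - h' x\<bar> \<partial>N) < e / 2"
        using add(4) e by blast
      have "(\<integral>x. \<bar>f x + h x - (f' x + h' x)\<bar> \<partial>N) \<le> (\<integral>x. \<bar>f x - f' x\<bar> + \<bar>h x - h' x\<bar> \<partial>N)"
        using add f' h' by (intro integral_mono) auto
      also have "\<dots> = (\<integral>x. \<bar>f x - f' x\<bar> \<partial>N) + (\<integral>x. \<bar>h x - h' x\<bar> \<partial>N)"
        using add f' h' by simp
      also have "\<dots> < e"
        using f' h' by simp
      finally show "\<exists>g. continuous_on UNIV g \<and> bounded (range g) \<and> integrable N g \<and>
          (\<integral>x. \<bar>f x + h x - g x\<bar> \<partial>N) < e"
        using f' h' by (intro exI[of _ "\<lambda>x. f' x + h' x"])
          (auto intro!: continuous_intros bounded_plus_comp)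
    qed
  next
    case (lim f s)
    show ?case
    proof (intro allI impI)
      fix e :: real assume "0 < e"
      then have e: "0 < e / 2"
        by simp
      have [measurable]: "integrable N f" "integrable N (s i)" for i
        using lim by auto
      \<comment> \<open>The induction supplies
        \<open>\<bar>s k x\<bar> \<le> 2 * \<bar>f x\<bar>\<close>, hence the majorant
        \<open>3 * \<bar>f x\<bar>\<close>.\<close>
      have "(\<lambda>k. \<integral>x. \<bar>f x - s k x\<bar> \<partial>N) \<longlonglongrightarrow> (\<integral>x. 0 \<partial>N)"
      proof (rule integral_dominated_convergence[where w = "\<lambda>x. 3 * \<bar>f x\<bar>"])
        show "AE x in N. (\<lambda>k. \<bar>f x - s k x\<bar>) \<longlonglongrightarrow> 0"
        proof (rule AE_I2)
          fix x assume "x \<in> space N"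
          then have "(\<lambda>k. \<bar>f x - s k x\<bar>) \<longlonglongrightarrow> \<bar>f x - f x\<bar>"
            by (intro tendsto_intros lim)
          then show "(\<lambda>k. \<bar>f x - s k x\<bar>) \<longlonglongrightarrow> 0"
            by simp
        qed
        show "AE x in N. norm \<bar>f x - s k x\<bar> \<le> 3 * \<bar>f x\<bar>" for k
        proof (rule AE_I2)
          fix x assume "x \<in> space N"
          then have "\<bar>s k x\<bar> \<le> 2 * \<bar>f x\<bar>"
            using lim.hyps(3)[of x k] by simp
          then show "norm \<bar>f x - s k x\<bar> \<le> 3 * \<bar>f x\<bar>"
            by simp
        qed
      qed (use lim in auto)
      then obtain k where k: "(\<integral>x. \<bar>f x - s k x\<bar> \<partial>N) < e / 2"
        using order_tendstoD(2)[of _ "0::real" sequentially "e / 2"] e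
        by (auto simp: eventually_sequentially)
      obtain g where g: "continuous_on UNIV g" "bounded (range g)" "integrable N g"
          "(\<integral>x. \<bar>s k x - g x\<bar> \<partial>N) < e / 2"
        using lim.IH[of k] e by blast
      have "(\<integral>x. \<bar>f x - g x\<bar> \<partial>N) < e"
        using tri[of f "s k" g] lim g k by fastforce
      then show "\<exists>g. continuous_on UNIV g \<and> bounded (range g) \<and> integrable N g \<and>
          (\<integral>x. \<bar>f x - g x\<bar> \<partial>N) < e"
        using g by blast
    qed
  qed
  then show ?thesis
    using \<open>0 < e\<close> that by blast
qed

subsection \<open>Strong laws for c.i.d. and i.i.d. sequences\<close>

text \<open>The disintegration is done with nonnegative integrals; the bounds make every inner
  integral finite, so both sides can be read as real integrals.\<close>

lemma (in prob_space) integral_bind_bounded: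
  fixes f :: "'b \<Rightarrow> real"
  assumes K: "K \<in> M \<rightarrow>\<^sub>M prob_algebra N" and f: "f \<in> borel_measurable N"
    and bounds: "\<And>y. 0 \<le> f y" "\<And>y. f y \<le> C"
  shows "(\<integral>y. f y \<partial>(M \<bind> K)) = (\<integral>x. \<integral>y. f y \<partial>K x \<partial>M)"
proof -
  have K': "K \<in> M \<rightarrow>\<^sub>M subprob_algebra N"
    by (rule measurable_prob_algebraD[OF K])
  have sets: "sets (M \<bind> K) = sets N"
    by (rule sets_bind[OF sets_kernel[OF K'] not_empty])
  have inner: "(\<integral>\<^sup>+y. ennreal (f y) \<partial>K x) = ennreal (\<integral>y. f y \<partial>K x)" if x: "x \<in> space M" for x
  proof -
    have "prob_space (K x)" and s: "sets (K x) = sets N"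
      using measurable_space[OF K x] by (auto simp: space_prob_algebra)
    then interpret K: prob_space "K x"
      by simp
    have "integrable (K x) f"
      using f bounds by (intro K.integrable_const_bound[where B = C])
        (auto simp: measurable_cong_sets[OF s refl])
    then show ?thesis
      using bounds by (intro nn_integral_eq_integral) auto
  qed
  have "(\<integral>y. f y \<partial>(M \<bind> K)) = enn2real (\<integral>\<^sup>+y. ennreal (f y) \<partial>(M \<bind> K))"
    using f bounds by (intro integral_eq_nn_integral) (auto simp: measurable_cong_sets[OF sets refl])
  also have "(\<integral>\<^sup>+y. ennreal (f y) \<partial>(M \<bind> K)) = (\<integral>\<^sup>+x. \<integral>\<^sup>+y. ennreal (f y) \<partial>K x \<partial>M)"
    using f by (intro nn_integral_bind[OF _ K']) simp
  also have "\<dots> = (\<integral>\<^sup>+x. ennreal (\<integral>y. f y \<partial>K x) \<partial>M)"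
    by (intro nn_integral_cong inner)
  also have "enn2real \<dots> = (\<integral>x. \<integral>y. f y \<partial>K x \<partial>M)"
    using measurable_compose[OF K' integral_measurable_subprob_algebra[OF f]] bounds
    by (intro integral_eq_nn_integral[symmetric]) auto
  finally show ?thesis .
qed

text \<open>Measurability of the real masses \<open>measure (\<alpha> \<omega>) B\<close> is
  upgraded to that of a kernel, so that the mean of \<alpha> can be formed as
  \<open>M \<bind> \<alpha>\<close>.\<close>

lemma measurable_random_measure:
  assumes "random_measure M \<alpha>"
  shows "\<alpha> \<in> M \<rightarrow>\<^sub>M prob_algebra borel"
proof (intro measurable_prob_algebraI measurable_subprob_algebra)
  fix \<omega> assume \<omega>: "\<omega> \<in> space M"
  then show p: "prob_space (\<alpha> \<omega>)"
    using assms by (simp add: random_measure_def)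
  then show "subprob_space (\<alpha> \<omega>)"
    by (rule prob_space_imp_subprob_space)
  show "sets (\<alpha> \<omega>) = sets borel"
    using assms \<omega> by (simp add: random_measure_def)
next
  fix B :: "'b set" assume B: "B \<in> sets borel"
  have "emeasure (\<alpha> \<omega>) B = ennreal (measure (\<alpha> \<omega>) B)" if "\<omega> \<in> space M" for \<omega>
    using assms that finite_measure.emeasure_eq_measure[OF prob_space.finite_measure]
    by (auto simp: random_measure_def)
  moreover have "(\<lambda>\<omega>. ennreal (measure (\<alpha> \<omega>) B)) \<in> borel_measurable M"
    using assms B by (auto simp: random_measure_def)
  ultimately show "(\<lambda>\<omega>. emeasure (\<alpha> \<omega>) B) \<in> borel_measurable M"
    by (simp cong: measurable_cong)
qed

section \<open>Measurability with respect to the past\<close>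

lemma past_field_generators:
  "{X i -` B \<inter> space M | i B. i < n \<and> B \<in> sets borel} \<subseteq> Pow (space M)"
  by auto

lemma space_past_field [simp]: "space (past_field M X n) = space M"
  by (simp add: past_field_def space_measure_of[OF past_field_generators])

lemma sets_past_field:
  "sets (past_field M X n) = sigma_sets (space M) {X i -` B \<inter> space M | i B. i < n \<and> B \<in> sets borel}"
  by (simp add: past_field_def sets_measure_of[OF past_field_generators])

lemma subalgebra_past_field:
  assumes "\<And>n. X n \<in> borel_measurable M"
  shows "subalgebra M (past_field M X n)"
  unfolding subalgebra_def sets_past_field
  using measurable_sets[OF assms] by (auto intro!: sets.sigma_sets_subset)

lemma sets_past_field_mono:
  "m \<le> n \<Longrightarrow> sets (past_field M X m) \<subseteq> sets (past_field M X n)"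
  unfolding sets_past_field by (rule sigma_sets_mono') (auto intro: less_le_trans)

lemma measurable_past_field:
  assumes "i < n"
  shows "X i \<in> borel_measurable (past_field M X n)"
proof (rule measurableI)
  fix B :: "'b set" assume "B \<in> sets borel"
  then show "X i -` B \<inter> space (past_field M X n) \<in> sets (past_field M X n)"
    using assms unfolding space_past_field sets_past_field by (intro sigma_sets.Basic) auto
qed simp

lemma (in prob_space) integrable_bounded_compose:
  fixes f :: "'e \<Rightarrow> real"
  assumes "X \<in> M \<rightarrow>\<^sub>M N" "f \<in> borel_measurable N" "bounded (range f)"
  shows "integrable M (\<lambda>\<omega>. f (X \<omega>))"
proof -
  obtain C where "\<And>x. \<bar>f x\<bar> \<le> C"
    using assms(3) by (auto simp: bounded_iff)
  then show ?thesis
    using assms(1,2) by (intro integrable_const_bound[where B = C]) auto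
qed

text \<open>With \<open>V i\<close> the prediction of \<open>f (X i)\<close>, the average splits
  into that of the errors \<open>Y i\<close>, which tends to 0 by orthogonality, and that of the
  \<open>V i\<close>, which has the same limit as the bounded martingale itself.\<close>

lemma (in prob_space) cid_predictive_limit:
  fixes X :: "nat \<Rightarrow> 'a \<Rightarrow> 'e::topological_space" and f :: "'e \<Rightarrow> real"
  assumes X[measurable]: "\<And>n. X n \<in> borel_measurable M" and "cid M X"
    and f[measurable]: "f \<in> borel_measurable borel" and bounded: "bounded (range f)"
  shows "AE \<omega> in M. (\<lambda>n. 1 / real n * (\<Sum>i<n. f (X i \<omega>))) \<longlonglongrightarrow> predictive_limit M X f \<omega>"
proof -
  let ?F = "past_field M X"
  define V where "V n = real_cond_exp M (?F n) (\<lambda>\<omega>. f (X n \<omega>))" for n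
  obtain C where C: "\<And>x. \<bar>f x\<bar> \<le> C"
    using bounded by (auto simp: bounded_iff)
  have sub: "subalgebra M (?F n)" for n
    by (rule subalgebra_past_field) (rule X)
  have sub_mono: "subalgebra (?F n) (?F m)" if "m \<le> n" for m n
    using sets_past_field_mono[OF that] by (simp add: subalgebra_def)
  have int: "integrable M (\<lambda>\<omega>. f (X n \<omega>))" for n
    by (rule integrable_bounded_compose[OF X f bounded])
  have VF: "V n \<in> borel_measurable (?F n)" for n
    by (simp add: V_def)
  have VM[measurable]: "V n \<in> borel_measurable M" for n
    by (simp add: V_def)
  have Vb: "AE \<omega> in M. \<bar>V n \<omega>\<bar> \<le> C" for n
  proof -
    interpret finite_measure_subalgebra M "?F n"
      by unfold_locales (rule sub)
    have le: "f x \<le> C" "- C \<le> f x" for x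
      using C[of x] by auto
    have "AE \<omega> in M. V n \<omega> \<le> C" "AE \<omega> in M. - C \<le> V n \<omega>"
      unfolding V_def by (intro real_cond_exp_le_c real_cond_exp_ge_c int AE_I2 le)+
    then show ?thesis
      by eventually_elim auto
  qed
  \<comment> \<open>The tower property turns the left side into the prediction of
    \<open>X (Suc n)\<close> from the first \<open>n\<close> variables; \<open>cid\<close> with
    \<open>k = Suc n\<close> identifies it with that of \<open>X n\<close>.\<close>
  have mart: "AE \<omega> in M. real_cond_exp M (?F n) (V (Suc n)) \<omega> = V n \<omega>" for n
  proof -
    interpret finite_measure_subalgebra M "?F n"
      by unfold_locales (rule sub)
    have "AE \<omega> in M. real_cond_exp M (?F n) (V (Suc n)) \<omega>
        = real_cond_exp M (?F n) (\<lambda>\<omega>. f (X (Suc n) \<omega>)) \<omega>"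
      unfolding V_def by (rule real_cond_exp_nested_subalg[OF sub sub_mono int]) simp
    moreover have "AE \<omega> in M. real_cond_exp M (?F n) (\<lambda>\<omega>. f (X (Suc n) \<omega>)) \<omega> = V n \<omega>"
      using \<open>cid M X\<close> bounded f unfolding cid_def V_def by (meson le_SucI order_refl)
    ultimately show ?thesis
      by eventually_elim simp
  qed
  have conv: "AE \<omega> in M. convergent (\<lambda>n. V n \<omega>)"
    by (rule bounded_martingale_convergent[where F = ?F and V = V and C = C, OF sub sets_past_field_mono VF Vb mart])
  define Y where "Y n \<omega> = f (X n \<omega>) - V n \<omega>" for n \<omega>
  have [measurable]: "Y n \<in> borel_measurable M" for n
    unfolding Y_def by measurable
  have Yb: "AE \<omega> in M. \<bar>Y n \<omega>\<bar> \<le> 2 * C" for n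
    using Vb[of n]
  proof eventually_elim
    case (elim \<omega>)
    then show ?case
      using C[of "X n \<omega>"] by (simp add: Y_def)
  qed
  \<comment> \<open>Strictness matters: \<open>past_field M X n\<close> is generated by the
    \<open>X i\<close> with \<open>i < n\<close>, while the prediction \<open>V i\<close> is already
    measurable for the field with index \<open>i\<close>.\<close>
  have YF: "Y i \<in> borel_measurable (?F n)" if "i < n" for i n
  proof -
    have "(\<lambda>\<omega>. f (X i \<omega>)) \<in> borel_measurable (?F n)"
      by (rule measurable_compose[OF measurable_past_field[OF that] f])
    moreover have "V i \<in> borel_measurable (?F n)"
      using measurable_from_subalg[OF sub_mono VF] that by simp
    ultimately show ?thesis
      unfolding Y_def by measurable
  qed
  have "AE \<omega> in M. (\<lambda>n. 1 / real n * (\<Sum>i<n. Y i \<omega>)) \<longlonglongrightarrow> 0"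
  proof (rule orthogonal_strong_law[OF _ Yb])
    fix i j :: nat assume ij: "i < j"
    interpret finite_measure_subalgebra M "?F j"
      by unfold_locales (rule sub)
    have i1: "integrable M (\<lambda>\<omega>. Y i \<omega> * f (X j \<omega>))"
    proof (rule integrable_const_bound)
      show "AE \<omega> in M. norm (Y i \<omega> * f (X j \<omega>)) \<le> 2 * C * C"
        using Yb[of i]
      proof eventually_elim
        case (elim \<omega>)
        then show ?case
          unfolding real_norm_def abs_mult by (intro mult_mono C) auto
      qed
    qed simp
    \<comment> \<open>\<open>Y i\<close> is measurable for the field with index \<open>j\<close>, so
      under the integral \<open>f (X j)\<close> may be replaced by its prediction
      \<open>V j\<close>, and the two terms cancel.\<close>
    note i2 = real_cond_exp_intg[OF i1 YF[OF ij], folded V_def]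
    have "(\<integral>\<omega>. Y i \<omega> * Y j \<omega> \<partial>M) = (\<integral>\<omega>. Y i \<omega> * f (X j \<omega>) - Y i \<omega> * V j \<omega> \<partial>M)"
      by (simp add: Y_def algebra_simps)
    also have "\<dots> = 0"
      using i1 i2 by simp
    finally show "(\<integral>\<omega>. Y i \<omega> * Y j \<omega> \<partial>M) = 0" .
  qed simp
  then show ?thesis
    using conv
  proof eventually_elim
    case (elim \<omega>)
    have "(\<lambda>n. V n \<omega>) \<longlonglongrightarrow> predictive_limit M X f \<omega>"
      using elim(2) unfolding predictive_limit_def V_def by (simp add: convergent_LIMSEQ_iff)
    then have "(\<lambda>n. 1 / real n * (\<Sum>i<n. Y i \<omega>) + 1 / real n * (\<Sum>i<n. V i \<omega>))
        \<longlonglongrightarrow> 0 + predictive_limit M X f \<omega>"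
      by (intro tendsto_add elim(1) average_tendsto)
    then show ?case
      by (simp add: Y_def sum_subtractf algebra_simps)
  qed
qed

text \<open>The case \<open>n = 0\<close> of \<open>cid\<close>: it equates the conditional
  expectations of all \<open>f (X n)\<close> given the same initial field, and integration removes
  the conditioning. Thus the \<open>X n\<close> share one law.\<close>

lemma (in prob_space) cid_integral_eq:
  fixes X :: "nat \<Rightarrow> 'a \<Rightarrow> 'e::topological_space" and f :: "'e \<Rightarrow> real"
  assumes X: "\<And>n. X n \<in> borel_measurable M" and "cid M X"
    and f: "f \<in> borel_measurable borel" "bounded (range f)"
  shows "(\<integral>\<omega>. f (X n \<omega>) \<partial>M) = (\<integral>\<omega>. f (X 0 \<omega>) \<partial>M)"
proof -
  let ?E = "\<lambda>n. real_cond_exp M (past_field M X 0) (\<lambda>\<omega>. f (X n \<omega>))"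
  interpret finite_measure_subalgebra M "past_field M X 0"
    by unfold_locales (rule subalgebra_past_field[OF X])
  have "(\<integral>\<omega>. ?E n \<omega> \<partial>M) = (\<integral>\<omega>. ?E 0 \<omega> \<partial>M)"
    using \<open>cid M X\<close> f by (intro integral_cong_AE) (auto simp: cid_def)
  then show ?thesis
    using real_cond_exp_int(2)[OF integrable_bounded_compose[OF X f]] by simp
qed

lemma (in prob_space) cid_expectation_average:
  fixes f :: "'e::topological_space \<Rightarrow> real"
  assumes X: "\<And>n. X n \<in> borel_measurable M" and "cid M X"
    and f: "f \<in> borel_measurable borel" "bounded (range f)" and "0 < n"
  shows "(\<integral>\<omega>. 1 / real n * (\<Sum>i<n. f (X i \<omega>)) \<partial>M) = (\<integral>\<omega>. f (X 0 \<omega>) \<partial>M)"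
proof -
  have "(\<integral>\<omega>. 1 / real n * (\<Sum>i<n. f (X i \<omega>)) \<partial>M) = 1 / real n * (\<Sum>i<n. \<integral>\<omega>. f (X i \<omega>) \<partial>M)"
    using integrable_bounded_compose[OF X f] by simp
  also have "(\<Sum>i<n. \<integral>\<omega>. f (X i \<omega>) \<partial>M) = (\<Sum>i<n. \<integral>\<omega>. f (X 0 \<omega>) \<partial>M)"
    by (intro sum.cong refl cid_integral_eq assms)
  finally show ?thesis
    using \<open>0 < n\<close> by simp
qed

lemma abs_average_le:
  fixes y :: "nat \<Rightarrow> real"
  assumes "\<And>i. \<bar>y i\<bar> \<le> C"
  shows "\<bar>1 / real n * (\<Sum>i<n. y i)\<bar> \<le> C"
proof (cases "n = 0")
  case True
  then show ?thesis
    using assms[of 0] by auto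
next
  case False
  have "\<bar>\<Sum>i<n. y i\<bar> \<le> (\<Sum>i<n. C)"
    by (rule order_trans[OF sum_abs]) (intro sum_mono assms)
  then show ?thesis
    using False by (simp add: abs_mult pos_divide_le_eq mult.commute)
qed

text \<open>For bounded continuous \<open>f\<close> the averages of \<open>f (X i)\<close> converge
  almost surely to the integral of \<open>f\<close> under \<alpha>, while their means stay equal to
  that of \<open>f (X 0)\<close>. Bounded convergence equates the two means, and such test functions
  determine the measure.\<close>

lemma (in prob_space) cid_mean_directing_measure:
  fixes X :: "nat \<Rightarrow> 'a \<Rightarrow> 'e::metric_space"
  assumes X[measurable]: "\<And>n. X n \<in> borel_measurable M" and cid: "cid M X"
    and \<alpha>: "directing_measure M X \<alpha>"
  shows "distr M borel (X 0) = M \<bind> \<alpha>"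
proof (rule measure_eqI_continuous)
  have K: "\<alpha> \<in> M \<rightarrow>\<^sub>M prob_algebra borel"
    using \<alpha> by (intro measurable_random_measure) (simp add: directing_measure_def)
  have M: "M \<in> space (prob_algebra M)"
    by (simp add: space_prob_algebra prob_space_axioms)
  show "finite_measure (distr M borel (X 0))"
    by (rule prob_space.finite_measure, rule prob_space_distr[OF X])
  show "finite_measure (M \<bind> \<alpha>)"
    by (rule prob_space.finite_measure, rule prob_space_bind'[OF M K])
  show "sets (M \<bind> \<alpha>) = sets borel"
    by (rule sets_bind'[OF M K])
  fix f :: "'e \<Rightarrow> real"
  assume f: "continuous_on UNIV f" "\<And>x. 0 \<le> f x" "\<And>x. f x \<le> 1"
  then have fb: "bounded (range f)"
    by (intro boundedI[of _ 1]) auto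
  have fm[measurable]: "f \<in> borel_measurable borel"
    by (rule borel_measurable_continuous_onI[OF f(1)])
  have "AE \<omega> in M. predictive_limit M X f \<omega> = (\<integral>t. f t \<partial>\<alpha> \<omega>)"
    using \<alpha> f(1) fb by (simp add: directing_measure_def)
  then have lim: "AE \<omega> in M. (\<lambda>n. 1 / real n * (\<Sum>i<n. f (X i \<omega>))) \<longlonglongrightarrow> (\<integral>t. f t \<partial>\<alpha> \<omega>)"
    using cid_predictive_limit[OF X cid fm fb] by eventually_elim simp
  have "(\<lambda>n. \<integral>\<omega>. 1 / real n * (\<Sum>i<n. f (X i \<omega>)) \<partial>M) \<longlonglongrightarrow> (\<integral>\<omega>. \<integral>t. f t \<partial>\<alpha> \<omega> \<partial>M)"
  proof (rule integral_dominated_convergence[OF _ _ _ lim])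
    show "(\<lambda>\<omega>. \<integral>t. f t \<partial>\<alpha> \<omega>) \<in> borel_measurable M"
      by (rule measurable_compose[OF measurable_prob_algebraD[OF K] integral_measurable_subprob_algebra[OF fm]])
    show "AE \<omega> in M. norm (1 / real n * (\<Sum>i<n. f (X i \<omega>))) \<le> 1" for n
      unfolding real_norm_def using f(2,3) by (intro AE_I2 abs_average_le) simp
  qed auto
  moreover have "\<forall>\<^sub>F n in sequentially. (\<integral>\<omega>. 1 / real n * (\<Sum>i<n. f (X i \<omega>)) \<partial>M) = (\<integral>\<omega>. f (X 0 \<omega>) \<partial>M)"
    by (intro eventually_sequentiallyI[of 1] cid_expectation_average X cid fm fb) simp
  then have "(\<lambda>n. \<integral>\<omega>. 1 / real n * (\<Sum>i<n. f (X i \<omega>)) \<partial>M) \<longlonglongrightarrow> (\<integral>\<omega>. f (X 0 \<omega>) \<partial>M)"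
    by (rule tendsto_eventually)
  ultimately have "(\<integral>\<omega>. f (X 0 \<omega>) \<partial>M) = (\<integral>\<omega>. \<integral>t. f t \<partial>\<alpha> \<omega> \<partial>M)"
    using LIMSEQ_unique by blast
  then show "(\<integral>x. f x \<partial>distr M borel (X 0)) = (\<integral>x. f x \<partial>(M \<bind> \<alpha>))"
    using integral_bind_bounded[OF K fm f(2,3)] by (simp add: integral_distr)
qed simp

text \<open>The limit \<open>V f\<close> and the integral \<open>W f\<close> agree for bounded
  continuous \<open>f\<close> by the choice of \<alpha>. Both maps do not increase the L1 distance
  measured under the law of \<open>X 0\<close>: the first through the averages, the second because
  that law is the mean of \<alpha>. Density then carries the agreement over to bounded measurable
  \<open>f\<close>.\<close>

lemma (in prob_space) cid_strong_law:
  fixes X :: "nat \<Rightarrow> 'a \<Rightarrow> 'e::polish_space" and f :: "'e \<Rightarrow> real"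
  assumes X[measurable]: "\<And>n. X n \<in> borel_measurable M" and cid: "cid M X"
    and \<alpha>: "directing_measure M X \<alpha>"
    and fm[measurable]: "f \<in> borel_measurable borel" and fb: "bounded (range f)"
  shows "AE \<omega> in M. (\<lambda>n. 1 / real n * (\<Sum>i<n. f (X i \<omega>))) \<longlonglongrightarrow> (\<integral>t. f t \<partial>\<alpha> \<omega>)"
proof -
  let ?A = "\<lambda>h n \<omega>. 1 / real n * (\<Sum>i<n. h (X i \<omega>))"
  define V where "V = predictive_limit M X"
  define W where "W h \<omega> = (\<integral>t. h t \<partial>\<alpha> \<omega>)" for h :: "'e \<Rightarrow> real" and \<omega>
  have K: "\<alpha> \<in> M \<rightarrow>\<^sub>M prob_algebra borel"
    using \<alpha> by (intro measurable_random_measure) (simp add: directing_measure_def)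
  \<comment> \<open>Valid for every \<open>h\<close>: \<open>real_cond_exp\<close> is always
    measurable, and so is a pointwise \<open>lim\<close> of measurable functions, whatever value it
    takes where the sequence diverges.\<close>
  have V_meas[measurable]: "V h \<in> borel_measurable M" for h
  proof -
    have "real_cond_exp M (past_field M X n) (\<lambda>\<omega>'. h (X n \<omega>')) \<in> borel_measurable M" for n
      by (rule borel_measurable_cond_exp2)
    then show ?thesis
      unfolding V_def predictive_limit_def by measurable
  qed
  have W_meas[measurable]: "W h \<in> borel_measurable M" if "h \<in> borel_measurable borel" for h
    unfolding W_def
    by (rule measurable_compose[OF measurable_prob_algebraD[OF K] integral_measurable_subprob_algebra[OF that]])
  have V_lim: "AE \<omega> in M. (\<lambda>n. ?A h n \<omega>) \<longlonglongrightarrow> V h \<omega>"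
    if "h \<in> borel_measurable borel" "bounded (range h)" for h
    unfolding V_def by (rule cid_predictive_limit[OF X cid that])
  have V_bound: "AE \<omega> in M. \<bar>V h \<omega>\<bar> \<le> C"
    if "h \<in> borel_measurable borel" "\<And>x. \<bar>h x\<bar> \<le> C" for h C
  proof -
    have "bounded (range h)"
      using that(2) by (intro boundedI[of _ C]) auto
    from V_lim[OF that(1) this] show ?thesis
    proof eventually_elim
      case (elim \<omega>)
      from tendsto_rabs[OF elim] show ?case
        by (rule LIMSEQ_le_const2) (use that(2) in \<open>auto intro!: exI[of _ 0] abs_average_le simp del: times_divide_eq_left\<close>)
    qed
  qed
  have W_bound: "\<bar>W h \<omega>\<bar> \<le> C" if "h \<in> borel_measurable borel" "\<And>x. \<bar>h x\<bar> \<le> C" "\<omega> \<in> space M" for h C \<omega>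
  proof -
    have "prob_space (\<alpha> \<omega>)" and s: "sets (\<alpha> \<omega>) = sets borel"
      using measurable_space[OF K that(3)] by (auto simp: space_prob_algebra)
    then interpret A: prob_space "\<alpha> \<omega>"
      by simp
    have "\<bar>W h \<omega>\<bar> \<le> (\<integral>t. \<bar>h t\<bar> \<partial>\<alpha> \<omega>)"
      unfolding W_def by (rule integral_abs_bound)
    also have "\<dots> \<le> C"
      using that(1,2) measurable_cong_sets[OF s refl, of borel]
      by (intro A.integral_le_const A.integrable_const_bound[where B = C]) auto
    finally show ?thesis .
  qed
  obtain C where C: "\<And>x. \<bar>f x\<bar> \<le> C"
    using fb by (auto simp: bounded_iff)
  have int: "integrable M (\<lambda>\<omega>. \<bar>V f \<omega> - W f \<omega>\<bar>)"
  proof (rule integrable_const_bound)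
    show "AE \<omega> in M. norm \<bar>V f \<omega> - W f \<omega>\<bar> \<le> C + C"
      using V_bound[OF fm C] AE_space
    proof eventually_elim
      case (elim \<omega>)
      then show ?case
        using W_bound[OF fm C elim(2)] by simp
    qed
  qed simp
  have small: "(\<integral>\<omega>. \<bar>V f \<omega> - W f \<omega>\<bar> \<partial>M) \<le> 2 * e" if e: "0 < e" for e
  proof -
    let ?N = "distr M borel (X 0)"
    interpret N: prob_space ?N
      by (rule prob_space_distr[OF X])
    obtain g where g: "continuous_on UNIV g" and gb: "bounded (range g)"
      and fg: "(\<integral>x. \<bar>f x - g x\<bar> \<partial>?N) < e"
    proof (rule continuous_dense_L1[OF _ _ _ e])
      show "finite_measure ?N"
        by unfold_locales
      show "integrable ?N f"
        using C by (intro N.integrable_const_bound[where B = C]) auto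
    qed auto
    have gm[measurable]: "g \<in> borel_measurable borel"
      by (rule borel_measurable_continuous_onI[OF g])
    obtain D where D: "\<And>x. \<bar>g x\<bar> \<le> D"
      using gb by (auto simp: bounded_iff)
    let ?h = "\<lambda>x. \<bar>f x - g x\<bar>"
    have hm: "?h \<in> borel_measurable borel"
      by measurable
    have hC: "?h x \<le> C + D" for x
      using C[of x] D[of x] by auto
    have hb: "bounded (range ?h)"
      using hC by (intro boundedI[of _ "C + D"]) auto
    have Vg: "AE \<omega> in M. V g \<omega> = W g \<omega>"
      using \<alpha> g gb by (simp add: directing_measure_def V_def W_def)
    \<comment> \<open>The mean distance of \<open>V f\<close> and \<open>V g\<close> is the limit of
      the mean distances of the averages, which the common law of the \<open>X i\<close> bounds by
      that of \<open>f\<close> and \<open>g\<close>.\<close>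
    have "(\<lambda>n. \<integral>\<omega>. \<bar>?A f n \<omega> - ?A g n \<omega>\<bar> \<partial>M) \<longlonglongrightarrow> (\<integral>\<omega>. \<bar>V f \<omega> - V g \<omega>\<bar> \<partial>M)"
    proof (rule integral_dominated_convergence[where w = "\<lambda>_. C + D"])
      show "AE \<omega> in M. (\<lambda>n. \<bar>?A f n \<omega> - ?A g n \<omega>\<bar>) \<longlonglongrightarrow> \<bar>V f \<omega> - V g \<omega>\<bar>"
        using V_lim[OF fm fb] V_lim[OF gm gb] by eventually_elim (intro tendsto_intros)
      show "AE \<omega> in M. norm \<bar>?A f n \<omega> - ?A g n \<omega>\<bar> \<le> C + D" for n
      proof (rule AE_I2)
        fix \<omega>
        have "\<bar>?A f n \<omega>\<bar> \<le> C" "\<bar>?A g n \<omega>\<bar> \<le> D"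
          using C D by (intro abs_average_le; simp)+
        then show "norm \<bar>?A f n \<omega> - ?A g n \<omega>\<bar> \<le> C + D"
          unfolding real_norm_def by linarith
      qed
    qed auto
    moreover have "\<forall>n\<ge>1. (\<integral>\<omega>. \<bar>?A f n \<omega> - ?A g n \<omega>\<bar> \<partial>M) \<le> e"
    proof (intro allI impI)
      fix n :: nat assume n: "1 \<le> n"
      have int: "integrable M (\<lambda>\<omega>. h (X i \<omega>))" if "h \<in> borel_measurable borel" "bounded (range h)" for i and h :: "'e \<Rightarrow> real"
        by (rule integrable_bounded_compose[OF X that])
      have "(\<integral>\<omega>. \<bar>?A f n \<omega> - ?A g n \<omega>\<bar> \<partial>M) \<le> (\<integral>\<omega>. ?A ?h n \<omega> \<partial>M)"
      proof (rule integral_mono)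
        show "integrable M (\<lambda>\<omega>. \<bar>?A f n \<omega> - ?A g n \<omega>\<bar>)"
          by (intro integrable_abs Bochner_Integration.integrable_diff integrable_mult_right
              Bochner_Integration.integrable_sum int fm gm fb gb)
        show "integrable M (\<lambda>\<omega>. ?A ?h n \<omega>)"
          by (intro integrable_mult_right Bochner_Integration.integrable_sum int hm hb)
        fix \<omega>
        have "?A f n \<omega> - ?A g n \<omega> = 1 / real n * (\<Sum>i<n. f (X i \<omega>) - g (X i \<omega>))"
          by (simp add: sum_subtractf diff_divide_distrib)
        then have "\<bar>?A f n \<omega> - ?A g n \<omega>\<bar> = 1 / real n * \<bar>\<Sum>i<n. f (X i \<omega>) - g (X i \<omega>)\<bar>"
          by (simp add: abs_mult)
        also have "\<dots> \<le> ?A ?h n \<omega>"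
          by (intro mult_left_mono sum_abs) simp
        finally show "\<bar>?A f n \<omega> - ?A g n \<omega>\<bar> \<le> ?A ?h n \<omega>" .
      qed
      also have "\<dots> = (\<integral>\<omega>. ?h (X 0 \<omega>) \<partial>M)"
        using n by (intro cid_expectation_average X cid hm hb) simp
      also have "\<dots> \<le> e"
        using fg by (simp add: integral_distr)
      finally show "(\<integral>\<omega>. \<bar>?A f n \<omega> - ?A g n \<omega>\<bar> \<partial>M) \<le> e" .
    qed
    ultimately have 1: "(\<integral>\<omega>. \<bar>V f \<omega> - V g \<omega>\<bar> \<partial>M) \<le> e"
      by (intro LIMSEQ_le_const2) auto
    have intV: "integrable M (\<lambda>\<omega>. \<bar>V f \<omega> - V g \<omega>\<bar>)"
    proof (rule integrable_const_bound)
      show "AE \<omega> in M. norm \<bar>V f \<omega> - V g \<omega>\<bar> \<le> C + D"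
        using V_bound[OF fm C] V_bound[OF gm D] by eventually_elim auto
    qed simp
    have intW: "integrable M (\<lambda>\<omega>. W ?h \<omega>)"
    proof (rule integrable_const_bound)
      show "AE \<omega> in M. norm (W ?h \<omega>) \<le> C + D"
        unfolding real_norm_def using hC by (intro AE_I2 W_bound hm) auto
    qed (rule W_meas[OF hm])
    \<comment> \<open>The law of \<open>X 0\<close> is the mean of \<alpha>, so the choice of
      \<open>g\<close> controls the error under the random measures on average as well.\<close>
    have "(\<integral>\<omega>. W ?h \<omega> \<partial>M) = (\<integral>x. ?h x \<partial>(M \<bind> \<alpha>))"
      unfolding W_def by (rule integral_bind_bounded[OF K hm _ hC, symmetric]) simp
    also have "\<dots> < e"
      using fg by (simp add: cid_mean_directing_measure[OF X cid \<alpha>])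
    finally have 2: "(\<integral>\<omega>. W ?h \<omega> \<partial>M) < e" .
    have Wle: "\<bar>W f \<omega> - W g \<omega>\<bar> \<le> W ?h \<omega>" if \<omega>: "\<omega> \<in> space M" for \<omega>
    proof -
      have "prob_space (\<alpha> \<omega>)" and s: "sets (\<alpha> \<omega>) = sets borel"
        using measurable_space[OF K \<omega>] by (auto simp: space_prob_algebra)
      then interpret A: prob_space "\<alpha> \<omega>"
        by simp
      have "integrable (\<alpha> \<omega>) f"
        using C fm by (intro A.integrable_const_bound[where B = C]) (auto simp: measurable_cong_sets[OF s refl])
      moreover have "integrable (\<alpha> \<omega>) g"
        using D gm by (intro A.integrable_const_bound[where B = D]) (auto simp: measurable_cong_sets[OF s refl])
      ultimately have "W f \<omega> - W g \<omega> = (\<integral>t. f t - g t \<partial>\<alpha> \<omega>)"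
        by (simp add: W_def)
      then show ?thesis
        using integral_abs_bound[of "\<alpha> \<omega>" "\<lambda>t. f t - g t"] by (simp add: W_def)
    qed
    \<comment> \<open>Triangle inequality through \<open>V g = W g\<close>, which holds almost
      surely because \<open>g\<close> is bounded and continuous.\<close>
    have "(\<integral>\<omega>. \<bar>V f \<omega> - W f \<omega>\<bar> \<partial>M) \<le> (\<integral>\<omega>. \<bar>V f \<omega> - V g \<omega>\<bar> + W ?h \<omega> \<partial>M)"
    proof (intro integral_mono_AE int Bochner_Integration.integrable_add intV intW)
      show "AE \<omega> in M. \<bar>V f \<omega> - W f \<omega>\<bar> \<le> \<bar>V f \<omega> - V g \<omega>\<bar> + W ?h \<omega>"
        using Vg AE_space
      proof eventually_elim
        case (elim \<omega>)
        then show ?case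
          using Wle[OF elim(2)] by linarith
      qed
    qed
    also have "\<dots> = (\<integral>\<omega>. \<bar>V f \<omega> - V g \<omega>\<bar> \<partial>M) + (\<integral>\<omega>. W ?h \<omega> \<partial>M)"
      by (rule Bochner_Integration.integral_add[OF intV intW])
    finally show ?thesis
      using 1 2 by linarith
  qed
  have "(\<integral>\<omega>. \<bar>V f \<omega> - W f \<omega>\<bar> \<partial>M) \<le> 0"
  proof (rule field_le_epsilon)
    fix e :: real assume "0 < e"
    then show "(\<integral>\<omega>. \<bar>V f \<omega> - W f \<omega>\<bar> \<partial>M) \<le> 0 + e"
      using small[of "e / 2"] by simp
  qed
  then have "(\<integral>\<omega>. \<bar>V f \<omega> - W f \<omega>\<bar> \<partial>M) = 0"
    by (intro antisym integral_nonneg_AE) auto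
  then have "AE \<omega> in M. \<bar>V f \<omega> - W f \<omega>\<bar> = 0"
    by (subst (asm) integral_nonneg_eq_0_iff_AE[OF int]) auto
  with V_lim[OF fm fb] show ?thesis
    by eventually_elim (simp add: W_def)
qed

text \<open>The centred values of \<open>f\<close> at the coordinates are bounded and orthogonal
  under the product measure, so the same \<open>orthogonal_strong_law\<close> applies that serves
  the c.i.d. sequence.\<close>

lemma (in prob_space) iid_strong_law:
  fixes f :: "'a \<Rightarrow> real"
  assumes f[measurable]: "f \<in> borel_measurable M" and "bounded (range f)"
  shows "AE x in PiM UNIV (\<lambda>_::nat. M). (\<lambda>n. 1 / real n * (\<Sum>i<n. f (x i))) \<longlonglongrightarrow> (\<integral>t. f t \<partial>M)"
proof -
  interpret PP: product_prob_space "\<lambda>_::nat. M" UNIV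
    by unfold_locales
  let ?P = "PiM UNIV (\<lambda>_::nat. M)"
  obtain C where C: "\<And>x. \<bar>f x\<bar> \<le> C"
    using assms(2) by (auto simp: bounded_iff)
  have int: "integrable M f"
    using C by (intro integrable_const_bound[where B = C]) auto
  define m where "m = (\<integral>t. f t \<partial>M)"
  define Y where "Y i x = f (x i) - m" for i :: nat and x :: "nat \<Rightarrow> 'a"
  have "AE x in ?P. (\<lambda>n. 1 / real n * (\<Sum>i<n. Y i x)) \<longlonglongrightarrow> 0"
  proof (rule PP.P.orthogonal_strong_law)
    show "Y i \<in> borel_measurable ?P" for i
      unfolding Y_def by measurable
    show "AE x in ?P. \<bar>Y i x\<bar> \<le> C + \<bar>m\<bar>" for i
    proof (rule AE_I2)
      fix x
      show "\<bar>Y i x\<bar> \<le> C + \<bar>m\<bar>"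
        using C[of "x i"] by (simp add: Y_def)
    qed
    fix i j :: nat assume ij: "i < j"
    \<comment> \<open>Restriction to two coordinates maps the infinite product to a finite one,
      where the integral factorises into integrals of \<open>f - m\<close>, each 0.\<close>
    let ?J = "{i, j}" and ?r = "\<lambda>x. \<lambda>n\<in>{i, j}. x n"
    have r: "distr ?P (PiM ?J (\<lambda>_. M)) ?r = PiM ?J (\<lambda>_. M)"
      using distr_PiM_reindex[of UNIV "\<lambda>_. M" "\<lambda>n. n" ?J] prob_space_axioms by simp
    have "(\<integral>x. Y i x * Y j x \<partial>?P) = (\<integral>x. (\<Prod>k\<in>?J. f (?r x k) - m) \<partial>?P)"
      using ij by (simp add: Y_def)
    also have "\<dots> = (\<integral>x. (\<Prod>k\<in>?J. f (x k) - m) \<partial>distr ?P (PiM ?J (\<lambda>_. M)) ?r)"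
      by (rule integral_distr[symmetric]) measurable
    also have "\<dots> = (\<integral>x. (\<Prod>k\<in>?J. f (x k) - m) \<partial>PiM ?J (\<lambda>_. M))"
      by (simp only: r)
    also have "\<dots> = (\<Prod>k\<in>?J. \<integral>x. f x - m \<partial>M)"
      using int by (intro PP.product_integral_prod) auto
    also have "\<dots> = 0"
      using int by (simp add: m_def prob_space card_gt_0_iff)
    finally show "(\<integral>x. Y i x * Y j x \<partial>?P) = 0" .
  qed
  then show ?thesis
  proof eventually_elim
    case (elim x)
    have "(\<lambda>n. 1 / real n * (\<Sum>i<n. Y i x) + 1 / real n * (\<Sum>i<n. m)) \<longlonglongrightarrow> 0 + m"
      by (intro tendsto_add elim average_tendsto tendsto_const)
    then show ?case
      by (simp add: Y_def m_def sum_subtractf algebra_simps)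
  qed
qed

subsection \<open>Coincidence on the limsup field\<close>

lemma limsup_average_eq:
  assumes "(\<lambda>n. 1 / real n * (\<Sum>i<n. f (x i))) \<longlonglongrightarrow> l"
  shows "limsup_average f x = ereal l"
  unfolding limsup_average_def using assms by (intro lim_imp_Limsup) (auto simp del: times_divide_eq_left)

theorem theorem2p6:
  fixes M :: "'a measure"
    and X :: "nat \<Rightarrow> 'a \<Rightarrow> 'e::polish_space"
    and \<alpha> :: "'a \<Rightarrow> 'e measure"
  assumes "prob_space M"
    and "\<And>n. X n \<in> borel_measurable M"
    and "cid M X"
    and "directing_measure M X \<alpha>"
  shows "exchangeable_law (iid_mixture M \<alpha>) \<and>
    (\<forall>A\<in>sets limsup_field.
      emeasure (distr M seq_borel (\<lambda>\<omega> n. X n \<omega>)) A = emeasure (iid_mixture M \<alpha>) A)"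
proof
  interpret prob_space M by fact
  note X[measurable] = assms(2)
  have \<alpha>: "random_measure M \<alpha>"
    using assms(4) by (simp add: directing_measure_def)
  let ?K = "\<lambda>\<omega>. PiM UNIV (\<lambda>_::nat. \<alpha> \<omega>)"
  let ?Q = "iid_mixture M \<alpha>"
  note emeasure_Q = emeasure_iid_mixture[OF assms(1) \<alpha>]
  have p\<alpha>: "prob_space (\<alpha> \<omega>)" and s\<alpha>: "sets (\<alpha> \<omega>) = sets borel" if "\<omega> \<in> space M" for \<omega>
    using \<alpha> that by (auto simp: random_measure_def)
  have pK: "prob_space (?K \<omega>)" and sK: "sets (?K \<omega>) = sets seq_borel" if "\<omega> \<in> space M" for \<omega>
    using p\<alpha>[OF that] s\<alpha>[OF that] unfolding seq_borel_def
    by (auto intro!: prob_space_PiM sets_PiM_cong)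
  note spK = sets_eq_imp_space_eq[OF sK]
  have space_seq: "space (seq_borel :: (nat \<Rightarrow> 'e) measure) = UNIV"
    by (simp add: seq_borel_def space_PiM)
  have sQ: "sets ?Q = sets seq_borel"
    by (simp add: iid_mixture_def sets.space_closed sets.sigma_sets_eq)
  have spQ: "space ?Q = space seq_borel"
    by (rule sets_eq_imp_space_eq[OF sQ])
  show "exchangeable_law ?Q"
    unfolding exchangeable_law_def
  proof (intro conjI allI impI sQ)
    have "emeasure ?Q (space ?Q) = (\<integral>\<^sup>+\<omega>. emeasure (?K \<omega>) (space seq_borel) \<partial>M)"
      by (simp add: spQ emeasure_Q)
    also have "\<dots> = (\<integral>\<^sup>+\<omega>. 1 \<partial>M)"
      by (intro nn_integral_cong) (simp add: spK[symmetric] prob_space.emeasure_space_1[OF pK])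
    finally show "prob_space ?Q"
      by (intro prob_spaceI) (simp add: emeasure_space_1)
    fix p :: "nat \<Rightarrow> nat" and S :: "nat set"
    assume p: "p permutes S"
    let ?T = "\<lambda>(x :: nat \<Rightarrow> 'e) i. x (p i)"
    have T[measurable]: "?T \<in> seq_borel \<rightarrow>\<^sub>M seq_borel"
      unfolding seq_borel_def by (rule measurable_PiM_single') (auto simp: space_PiM)
    have TQ: "?T \<in> ?Q \<rightarrow>\<^sub>M seq_borel"
      by (simp add: measurable_cong_sets[OF sQ refl])
    show "distr ?Q seq_borel ?T = ?Q"
    proof (rule measure_eqI)
      fix A assume "A \<in> sets (distr ?Q seq_borel ?T)"
      then have A[measurable]: "A \<in> sets seq_borel"
        by simp
      have TA: "?T -` A \<inter> space seq_borel \<in> sets seq_borel"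
        by (rule measurable_sets[OF T A])
      have "emeasure (?K \<omega>) (?T -` A \<inter> space seq_borel) = emeasure (?K \<omega>) A" if \<omega>: "\<omega> \<in> space M" for \<omega>
      proof -
        \<comment> \<open>Reindexing a product with identical factors by an injection leaves it
          unchanged. Every \<open>?K \<omega>\<close> is thus invariant under \<open>?T\<close>, and
          integration over \<omega> passes this on to the mixture.\<close>
        have "distr (?K \<omega>) (?K \<omega>) (\<lambda>x. \<lambda>n\<in>UNIV. x (p n)) = ?K \<omega>"
          using distr_PiM_reindex[of UNIV "\<lambda>_. \<alpha> \<omega>" p UNIV] p\<alpha>[OF \<omega>] permutes_inj[OF p] by simp
        then have d: "distr (?K \<omega>) (?K \<omega>) ?T = ?K \<omega>"
          by (simp add: restrict_UNIV)
        have "emeasure (distr (?K \<omega>) (?K \<omega>) ?T) A = emeasure (?K \<omega>) (?T -` A \<inter> space (?K \<omega>))"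
          by (rule emeasure_distr) (simp_all add: measurable_cong_sets[OF sK[OF \<omega>] sK[OF \<omega>]] sK[OF \<omega>])
        then show ?thesis
          by (simp add: d spK[OF \<omega>])
      qed
      then have "(\<integral>\<^sup>+\<omega>. emeasure (?K \<omega>) (?T -` A \<inter> space seq_borel) \<partial>M) = (\<integral>\<^sup>+\<omega>. emeasure (?K \<omega>) A \<partial>M)"
        by (rule nn_integral_cong)
      then show "emeasure (distr ?Q seq_borel ?T) A = emeasure ?Q A"
        using TA by (simp add: emeasure_distr[OF TQ A] spQ emeasure_Q[OF A] emeasure_Q[OF TA])
    qed (simp add: sQ)
  qed
  let ?X = "\<lambda>\<omega> n. X n \<omega>"
  have Xm: "?X \<in> M \<rightarrow>\<^sub>M seq_borel"
    unfolding seq_borel_def by (rule measurable_PiM_single') auto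
  \<comment> \<open>The exceptional null set may depend on \<open>A\<close>; each step of the
    induction unites at most countably many of them.\<close>
  have zero_one: "AE \<omega> in M. emeasure (?K \<omega>) A = indicator A (?X \<omega>)"
    if "A \<in> sets limsup_field" for A
  proof -
    let ?G = "{limsup_average f -` B \<inter> space seq_borel | (f :: 'e \<Rightarrow> real) B.
       f \<in> borel_measurable borel \<and> bounded (range f) \<and> B \<in> sets borel}"
    have field: "sets limsup_field = sigma_sets (space seq_borel) ?G"
      unfolding limsup_field_def by (rule sets_measure_of) auto
    have meas: "A \<in> sets seq_borel" if "A \<in> sigma_sets (space seq_borel) ?G" for A
      using that sets_limsup_field field by blast
    from that have "A \<in> sigma_sets (space seq_borel) ?G"
      by (simp only: field)
    then show ?thesis
    proof induction
      case (Basic A)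
      then obtain f :: "'e \<Rightarrow> real" and B where A: "A = limsup_average f -` B \<inter> space seq_borel"
        and f: "f \<in> borel_measurable borel" "bounded (range f)" and B: "B \<in> sets borel"
        by blast
      have AM: "A \<in> sets seq_borel"
        using Basic by (intro meas sigma_sets.Basic)
      show ?case
        using cid_strong_law[OF X assms(3,4) f] AE_space
      proof eventually_elim
        case (elim \<omega>)
        let ?m = "ereal (\<integral>t. f t \<partial>\<alpha> \<omega>)"
        interpret A: prob_space "\<alpha> \<omega>"
          by (rule p\<alpha>[OF elim(2)])
        interpret K: prob_space "?K \<omega>"
          by (rule pK[OF elim(2)])
        have "limsup_average f (?X \<omega>) = ?m"
          by (rule limsup_average_eq[of f "?X \<omega>", OF elim(1)])
        moreover have "AE x in ?K \<omega>. limsup_average f x = ?m"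
          using A.iid_strong_law[of f] f limsup_average_eq[of f]
          by (auto simp: measurable_cong_sets[OF s\<alpha>[OF elim(2)] refl] elim: eventually_mono)
        \<comment> \<open>Membership in \<open>A\<close> depends on \<open>x\<close> only through
          its limsup average, which is almost surely \<open>?m\<close> under
          \<open>?K \<omega>\<close> and equals \<open>?m\<close> at \<open>?X \<omega>\<close> too.
          So \<open>A\<close> has mass 1 or 0 according to whether \<open>?m\<close> lies in
          \<open>B\<close>.\<close>
        then have "AE x in ?K \<omega>. x \<in> A \<longleftrightarrow> ?m \<in> B"
          by eventually_elim (simp add: A space_seq)
        then have "emeasure (?K \<omega>) A = indicator B ?m"
          using AM sK[OF elim(2)] K.emeasure_eq_1_AE[of A] emeasure_eq_0_AE[of "\<lambda>x. x \<in> A" "?K \<omega>"]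
          by (cases "?m \<in> B") (auto simp: spK[OF elim(2)] space_seq)
        ultimately show ?case
          by (simp add: A space_seq indicator_def)
      qed
    next
      case Empty
      then show ?case
        by simp
    next
      case (Compl A)
      show ?case
        using Compl.IH AE_space
      proof eventually_elim
        case (elim \<omega>)
        interpret K: prob_space "?K \<omega>"
          by (rule pK[OF elim(2)])
        have "emeasure (?K \<omega>) (space (?K \<omega>) - A) = 1 - emeasure (?K \<omega>) A"
          using meas[OF Compl.hyps] sK[OF elim(2)] K.emeasure_space_1 by (subst emeasure_compl) auto
        then show ?case
          using elim(1) by (auto simp: spK[OF elim(2)] space_seq indicator_def)
      qed
    next
      case (Union A)
      have "AE \<omega> in M. \<forall>i. emeasure (?K \<omega>) (A i) = indicator (A i) (?X \<omega>)"
        unfolding AE_all_countable using Union.IH by blast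
      then show ?case
        using AE_space
      proof eventually_elim
        case (elim \<omega>)
        interpret K: prob_space "?K \<omega>"
          by (rule pK[OF elim(2)])
        have A: "range A \<subseteq> sets (?K \<omega>)"
          using meas[OF Union.hyps] sK[OF elim(2)] by auto
        \<comment> \<open>Either some \<open>A i\<close> contains the path and has mass 1, which
          forces mass 1 on the union, or every \<open>A i\<close> is null and so is the countable
          union.\<close>
        show ?case
        proof (cases "\<exists>i. ?X \<omega> \<in> A i")
          case True
          then obtain i where i: "?X \<omega> \<in> A i"
            by blast
          have "1 \<le> emeasure (?K \<omega>) (\<Union>i. A i)"
            using elim(1) i A emeasure_mono[of "A i" "\<Union>i. A i" "?K \<omega>"] by (auto simp: indicator_def)
          then have "emeasure (?K \<omega>) (\<Union>i. A i) = 1"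
            by (intro antisym K.measure_le_1)
          then show ?thesis
            using i by (auto simp: indicator_def)
        next
          case False
          then have "emeasure (?K \<omega>) (\<Union>i. A i) = 0"
            using elim(1) by (intro emeasure_UN_eq_0 A) auto
          then show ?thesis
            using False by (simp add: indicator_def)
        qed
      qed
    qed
  qed
  show "\<forall>A\<in>sets limsup_field. emeasure (distr M seq_borel ?X) A = emeasure ?Q A"
  proof
    fix A :: "(nat \<Rightarrow> 'e) set" assume A: "A \<in> sets limsup_field"
    then have AM: "A \<in> sets seq_borel"
      using sets_limsup_field by blast
    have "emeasure (distr M seq_borel ?X) A = (\<integral>\<^sup>+x. indicator A x \<partial>distr M seq_borel ?X)"
      using AM by simp
    also have "\<dots> = (\<integral>\<^sup>+\<omega>. indicator A (?X \<omega>) \<partial>M)"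
      using AM by (intro nn_integral_distr[OF Xm]) simp
    also have "\<dots> = (\<integral>\<^sup>+\<omega>. emeasure (?K \<omega>) A \<partial>M)"
      using zero_one[OF A] by (intro nn_integral_cong_AE) auto
    also have "\<dots> = emeasure ?Q A"
      by (rule emeasure_Q[OF AM, symmetric])
    finally show "emeasure (distr M seq_borel ?X) A = emeasure ?Q A" .
  qed
qed

end
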